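(* Let $K$ be a field of characteristic other than $2$ containing a square root of $-1$, and let $L_K$ be the Lorentz type algebra over $K$. Then the derivation algebra of $L_K$ is isomorphic to $\mathfrak{sl}_2(K)^2=\mathfrak{sl}_2(K)\times\mathfrak{sl}_2(K)$, and the automorphism group $\mathrm{Aut}(L_K)$ is isomorphic to $\mathrm{PGL}_2(K)^2\rtimes\mu_2(K)$, where $\mu_2(K)=\{x\in K^\times:x^2=1\}=\{\pm1\}$ and $-1$ acts on $\mathrm{PGL}_2(K)^2$ by swapping the two factors.
   Context: For a commutative unital ring $R$, the Lorentz type algebra $L_R$ is the Lie $R$-algebra which is free as an $R$-module with basis $b_1,\dots,b_6$ and whose (alternating) bracket is given by $[b_1,b_2]=b_4$, $[b_1,b_3]=b_5$, $[b_1,b_4]=b_2$, $[b_1,b_5]=b_3$, $[b_1,b_6]=0$, $[b_2,b_3]=b_6$, $[b_2,b_4]=-b_1$, $[b_2,b_5]=0$, $[b_2,b_6]=b_3$, $[b_3,b_4]=0$, $[b_3,b_5]=-b_1$, $[b_3,b_6]=-b_2$, $[b_4,b_5]=-b_6$, $[b_4,b_6]=b_5$, $[b_5,b_6]=-b_4$. Here $\mathrm{PGL}_2(K)=\mathrm{GL}_2(K)/K^\times$; derivations and automorphisms are those of the Lie $K$-algebra $L_K$. *)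

theory Defs
  imports "HOL-Analysis.Determinants" "HOL-Algebra.Coset" "HOL-Algebra.Bij"
begin

section \<open>Lie algebras, derivations, automorphisms\<close>

record ('k, 'v) lie_alg = "'v partial_object" +
  ladd :: "'v \<Rightarrow> 'v \<Rightarrow> 'v"
  lzero :: 'v
  lscale :: "'k \<Rightarrow> 'v \<Rightarrow> 'v"
  lbracket :: "'v \<Rightarrow> 'v \<Rightarrow> 'v"

locale lie_algebra =
  fixes L :: "('k::comm_ring_1, 'v) lie_alg"
  assumes additive: "comm_group \<lparr>carrier = carrier L, mult = ladd L, one = lzero L\<rparr>"
    and scale_closed: "x \<in> carrier L \<Longrightarrow> lscale L c x \<in> carrier L"
    and scale_add_right: "\<lbrakk>x \<in> carrier L; y \<in> carrier L\<rbrakk> \<Longrightarrow>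
      lscale L c (ladd L x y) = ladd L (lscale L c x) (lscale L c y)"
    and scale_add_left: "x \<in> carrier L \<Longrightarrow>
      lscale L (c + d) x = ladd L (lscale L c x) (lscale L d x)"
    and scale_scale: "x \<in> carrier L \<Longrightarrow> lscale L c (lscale L d x) = lscale L (c * d) x"
    and scale_one: "x \<in> carrier L \<Longrightarrow> lscale L 1 x = x"
    and bracket_closed: "\<lbrakk>x \<in> carrier L; y \<in> carrier L\<rbrakk> \<Longrightarrow> lbracket L x y \<in> carrier L"
    and bracket_add_left: "\<lbrakk>x \<in> carrier L; y \<in> carrier L; z \<in> carrier L\<rbrakk> \<Longrightarrow>
      lbracket L (ladd L x y) z = ladd L (lbracket L x z) (lbracket L y z)"
    and bracket_add_right: "\<lbrakk>x \<in> carrier L; y \<in> carrier L; z \<in> carrier L\<rbrakk> \<Longrightarrow>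
      lbracket L x (ladd L y z) = ladd L (lbracket L x y) (lbracket L x z)"
    and bracket_scale_left: "\<lbrakk>x \<in> carrier L; y \<in> carrier L\<rbrakk> \<Longrightarrow>
      lbracket L (lscale L c x) y = lscale L c (lbracket L x y)"
    and bracket_scale_right: "\<lbrakk>x \<in> carrier L; y \<in> carrier L\<rbrakk> \<Longrightarrow>
      lbracket L x (lscale L c y) = lscale L c (lbracket L x y)"
    and bracket_self: "x \<in> carrier L \<Longrightarrow> lbracket L x x = lzero L"
    and jacobi: "\<lbrakk>x \<in> carrier L; y \<in> carrier L; z \<in> carrier L\<rbrakk> \<Longrightarrow>
      ladd L (ladd L (lbracket L x (lbracket L y z)) (lbracket L y (lbracket L z x)))
        (lbracket L z (lbracket L x y)) = lzero L"

definition lie_linear :: "('k, 'v) lie_alg \<Rightarrow> ('k, 'w) lie_alg \<Rightarrow> ('v \<Rightarrow> 'w) set" where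
  "lie_linear L M = {f \<in> carrier L \<rightarrow> carrier M.
     (\<forall>x\<in>carrier L. \<forall>y\<in>carrier L. f (ladd L x y) = ladd M (f x) (f y)) \<and>
     (\<forall>c. \<forall>x\<in>carrier L. f (lscale L c x) = lscale M c (f x))}"

definition lie_hom :: "('k, 'v) lie_alg \<Rightarrow> ('k, 'w) lie_alg \<Rightarrow> ('v \<Rightarrow> 'w) set" where
  "lie_hom L M = {f \<in> lie_linear L M.
     \<forall>x\<in>carrier L. \<forall>y\<in>carrier L. f (lbracket L x y) = lbracket M (f x) (f y)}"

definition lie_isomorphic :: "('k, 'v) lie_alg \<Rightarrow> ('k, 'w) lie_alg \<Rightarrow> bool" where
  "lie_isomorphic L M \<longleftrightarrow> (\<exists>f \<in> lie_hom L M. bij_betw f (carrier L) (carrier M))"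

definition lie_prod :: "('k, 'v) lie_alg \<Rightarrow> ('k, 'w) lie_alg \<Rightarrow> ('k, 'v \<times> 'w) lie_alg" where
  "lie_prod L M = \<lparr>carrier = carrier L \<times> carrier M,
     ladd = (\<lambda>(x, y) (x', y'). (ladd L x x', ladd M y y')),
     lzero = (lzero L, lzero M),
     lscale = (\<lambda>c (x, y). (lscale L c x, lscale M c y)),
     lbracket = (\<lambda>(x, y) (x', y'). (lbracket L x x', lbracket M y y'))\<rparr>"

text \<open>As for \<^const>\<open>Bij\<close>, derivations and automorphisms are required to be extensional on the
  carrier, so that each one is represented by exactly one function.\<close>

definition derivations :: "('k, 'v) lie_alg \<Rightarrow> ('v \<Rightarrow> 'v) set" where
  "derivations L = {d \<in> lie_linear L L \<inter> extensional (carrier L).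
     \<forall>x\<in>carrier L. \<forall>y\<in>carrier L.
       d (lbracket L x y) = ladd L (lbracket L (d x) y) (lbracket L x (d y))}"

definition derivation_algebra :: "('k::comm_ring_1, 'v) lie_alg \<Rightarrow> ('k, 'v \<Rightarrow> 'v) lie_alg" where
  "derivation_algebra L = \<lparr>carrier = derivations L,
     ladd = (\<lambda>d e. \<lambda>x\<in>carrier L. ladd L (d x) (e x)),
     lzero = (\<lambda>x\<in>carrier L. lzero L),
     lscale = (\<lambda>c d. \<lambda>x\<in>carrier L. lscale L c (d x)),
     lbracket = (\<lambda>d e. \<lambda>x\<in>carrier L. ladd L (d (e x)) (lscale L (- 1) (e (d x))))\<rparr>"

definition lie_auto :: "('k, 'v) lie_alg \<Rightarrow> ('v \<Rightarrow> 'v) set" where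
  "lie_auto L = lie_hom L L \<inter> Bij (carrier L)"

definition lie_auto_group :: "('k, 'v) lie_alg \<Rightarrow> ('v \<Rightarrow> 'v) monoid" where
  "lie_auto_group L = BijGroup (carrier L) \<lparr>carrier := lie_auto L\<rparr>"

context lie_algebra
begin

abbreviation (input) additive_group where
  "additive_group \<equiv> \<lparr>carrier = carrier L, mult = ladd L, one = lzero L\<rparr>"

sublocale add: comm_group additive_group
  rewrites "carrier additive_group = carrier L" and "mult additive_group = ladd L"
    and "one additive_group = lzero L"
  by (simp_all add: additive)

lemma scale_zero: "lscale L c (lzero L) = lzero L"
  using scale_add_right[of "lzero L" "lzero L" c] scale_closed[of "lzero L" c]
  by (metis add.l_cancel_one add.one_closed add.r_one)

lemma scale_zero_left: "x \<in> carrier L \<Longrightarrow> lscale L 0 x = lzero L"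
  using scale_add_left[of x 0 0] scale_closed[of x 0]
  by (metis add.l_cancel_one add_0)

lemma add_minus: "x \<in> carrier L \<Longrightarrow> ladd L x (lscale L (- 1) x) = lzero L"
  using scale_add_left[of x 1 "- 1"] by (simp add: scale_one scale_zero_left)

lemma group_lie_auto_group: "group (lie_auto_group L)"
proof -
  have "subgroup (lie_auto L) (BijGroup (carrier L))"
  proof (rule subgroup.intro)
    show "lie_auto L \<subseteq> carrier (BijGroup (carrier L))"
      by (auto simp: lie_auto_def BijGroup_def)
  next
    fix f g assume fg: "f \<in> lie_auto L" "g \<in> lie_auto L"
    then have B: "f \<in> Bij (carrier L)" "g \<in> Bij (carrier L)"
      by (auto simp: lie_auto_def)
    have "compose (carrier L) f g \<in> lie_hom L L"
      using fg add.m_closed scale_closed bracket_closed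
      by (auto simp: lie_auto_def lie_hom_def lie_linear_def compose_def Pi_iff)
    then show "f \<otimes>\<^bsub>BijGroup (carrier L)\<^esub> g \<in> lie_auto L"
      using B by (simp add: lie_auto_def BijGroup_def compose_Bij)
  next
    show "\<one>\<^bsub>BijGroup (carrier L)\<^esub> \<in> lie_auto L"
      using add.m_closed scale_closed bracket_closed
      by (auto simp: lie_auto_def lie_hom_def lie_linear_def BijGroup_def id_Bij)
  next
    fix f assume f: "f \<in> lie_auto L"
    then have B: "f \<in> Bij (carrier L)" by (auto simp: lie_auto_def)
    let ?g = "inv_into (carrier L) f"
    have g: "?g x \<in> carrier L" "f (?g x) = x" if "x \<in> carrier L" for x
      using B that by (auto simp: Bij_def bij_betw_def inv_into_into f_inv_into_f)
    have gf: "?g (f x) = x" if "x \<in> carrier L" for x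
      using B that by (auto simp: Bij_def bij_betw_def)
    have f_eqs: "f (ladd L x y) = ladd L (f x) (f y)" "f (lscale L c x) = lscale L c (f x)"
      "f (lbracket L x y) = lbracket L (f x) (f y)"
      if "x \<in> carrier L" "y \<in> carrier L" for x y c
      using f that by (auto simp: lie_auto_def lie_hom_def lie_linear_def)
    have "restrict ?g (carrier L) \<in> lie_hom L L"
      unfolding lie_hom_def lie_linear_def
    proof (safe intro!: restrictI)
      fix x assume x: "x \<in> carrier L"
      show "?g x \<in> carrier L" using g x by blast
      fix c
      show "restrict ?g (carrier L) (lscale L c x) = lscale L c (restrict ?g (carrier L) x)"
        using x g[OF x] f_eqs(2)[of "?g x" "?g x" c] gf[of "lscale L c (?g x)"]
        by (simp add: scale_closed)
      fix y assume y: "y \<in> carrier L"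
      show "restrict ?g (carrier L) (ladd L x y)
          = ladd L (restrict ?g (carrier L) x) (restrict ?g (carrier L) y)"
        using x y g[OF x] g[OF y] f_eqs(1)[of "?g x" "?g y"] gf[of "ladd L (?g x) (?g y)"]
        by simp
      show "restrict ?g (carrier L) (lbracket L x y)
          = lbracket L (restrict ?g (carrier L) x) (restrict ?g (carrier L) y)"
        using x y g[OF x] g[OF y] f_eqs(3)[of "?g x" "?g y"] gf[of "lbracket L (?g x) (?g y)"]
        by (simp add: bracket_closed)
    qed
    then show "inv\<^bsub>BijGroup (carrier L)\<^esub> f \<in> lie_auto L"
      using B by (simp add: lie_auto_def inv_BijGroup restrict_inv_into_Bij)
  qed
  then show ?thesis
    by (simp add: lie_auto_group_def subgroup.subgroup_is_group group_BijGroup)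
qed

lemma derivationsD:
  assumes "d \<in> derivations L" "x \<in> carrier L"
  shows "d x \<in> carrier L" "d (lscale L c x) = lscale L c (d x)"
    and "y \<in> carrier L \<Longrightarrow> d (ladd L x y) = ladd L (d x) (d y)"
    and "y \<in> carrier L \<Longrightarrow>
      d (lbracket L x y) = ladd L (lbracket L (d x) y) (lbracket L x (d y))"
  using assms by (auto simp: derivations_def lie_linear_def)

lemma derivations_eqI:
  assumes "d \<in> derivations L" "e \<in> derivations L" "\<And>x. x \<in> carrier L \<Longrightarrow> d x = e x"
  shows "d = e"
  using assms by (auto simp: derivations_def intro: extensionalityI)

lemma zero_derivation: "lzero (derivation_algebra L) \<in> derivations L"
proof -
  have "lbracket L x (lzero L) = lzero L" "lbracket L (lzero L) x = lzero L"
    if "x \<in> carrier L" for x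
    using that bracket_scale_right[of x "lzero L" 0] bracket_scale_left[of "lzero L" x 0]
    by (simp_all add: bracket_closed scale_zero_left)
  then show ?thesis
    by (auto simp: derivations_def lie_linear_def derivation_algebra_def scale_closed
        bracket_closed scale_zero)
qed

lemma derivation_algebra_closed:
  assumes "d \<in> derivations L" "e \<in> derivations L"
  shows "ladd (derivation_algebra L) d e \<in> derivations L"
    and "lscale (derivation_algebra L) c d \<in> derivations L"
    and "lbracket (derivation_algebra L) d e \<in> derivations L"
proof -
  note D = derivationsD[OF assms(1)] derivationsD[OF assms(2)]
  note C = D(1,5) scale_closed bracket_closed
  note R = D scale_closed bracket_closed scale_add_right bracket_add_left bracket_add_right
    bracket_scale_left bracket_scale_right add.m_ac
  show "ladd (derivation_algebra L) d e \<in> derivations L"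
    by (auto simp: derivations_def lie_linear_def derivation_algebra_def R)
  show "lscale (derivation_algebra L) c d \<in> derivations L"
    by (auto simp: derivations_def lie_linear_def derivation_algebra_def R scale_scale mult.commute)
  show "lbracket (derivation_algebra L) d e \<in> derivations L"
  proof -
    let ?m = "lscale L (- 1)"
    have leib: "ladd L (d (e (lbracket L x y))) (?m (e (d (lbracket L x y)))) =
       ladd L (lbracket L (ladd L (d (e x)) (?m (e (d x)))) y)
         (lbracket L x (ladd L (d (e y)) (?m (e (d y)))))"
      if xy: "x \<in> carrier L" "y \<in> carrier L" for x y
    proof -
      let ?p = "lbracket L (d x) (e y)" and ?q = "lbracket L (e x) (d y)"
      let ?S = "ladd L (lbracket L (ladd L (d (e x)) (?m (e (d x)))) y)
         (lbracket L x (ladd L (d (e y)) (?m (e (d y)))))"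
      have "ladd L (d (e (lbracket L x y))) (?m (e (d (lbracket L x y)))) =
        ladd L ?S (ladd L (ladd L ?p (?m ?p)) (ladd L ?q (?m ?q)))"
        using xy by (simp add: R)
      then show ?thesis
        using xy by (simp add: add_minus C)
    qed
    show ?thesis
      using leib
      by (auto simp: derivations_def lie_linear_def derivation_algebra_def R scale_scale
           mult.commute)
  qed
qed

lemma carrier_derivation_algebra: "carrier (derivation_algebra L) = derivations L"
  by (simp add: derivation_algebra_def)

lemma derivation_algebra_apply:
  assumes "x \<in> carrier L"
  shows "ladd (derivation_algebra L) d e x = ladd L (d x) (e x)"
    and "lzero (derivation_algebra L) x = lzero L"
    and "lscale (derivation_algebra L) c d x = lscale L c (d x)"
    and "lbracket (derivation_algebra L) d e x = ladd L (d (e x)) (lscale L (- 1) (e (d x)))"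
  using assms by (simp_all add: derivation_algebra_def)

lemma lie_algebra_derivation_algebra: "lie_algebra (derivation_algebra L)"
proof (rule lie_algebra.intro)
  let ?D = "derivation_algebra L"
  let ?G = "\<lparr>carrier = carrier ?D, mult = ladd ?D, one = lzero ?D\<rparr>"
  note R = carrier_derivation_algebra derivation_algebra_apply derivation_algebra_closed
    zero_derivation derivationsD scale_closed scale_add_right scale_add_left scale_scale scale_one
  show "comm_group ?G"
  proof (rule comm_groupI)
    fix d assume "d \<in> carrier ?G"
    then show "\<exists>e\<in>carrier ?G. e \<otimes>\<^bsub>?G\<^esub> d = \<one>\<^bsub>?G\<^esub>"
      by (intro bexI[of _ "lscale ?D (- 1) d"])
        (auto intro!: derivations_eqI simp: R add.m_comm add_minus)
  qed (auto intro!: derivations_eqI simp: R add.m_ac)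
  fix d e f assume def: "d \<in> carrier ?D" "e \<in> carrier ?D" "f \<in> carrier ?D"
  show "ladd ?D (ladd ?D (lbracket ?D d (lbracket ?D e f)) (lbracket ?D e (lbracket ?D f d)))
        (lbracket ?D f (lbracket ?D d e)) = lzero ?D"
  proof (rule derivations_eqI)
    fix x assume x: "x \<in> carrier L"
    define t where "t = (\<lambda>y. ladd L y (lscale L (- 1) y))"
    have t: "t y = lzero L" if "y \<in> carrier L" for y
      using that by (simp add: t_def add_minus)
    have "ladd ?D (ladd ?D (lbracket ?D d (lbracket ?D e f)) (lbracket ?D e (lbracket ?D f d)))
        (lbracket ?D f (lbracket ?D d e)) x =
      ladd L (t (d (e (f x)))) (ladd L (t (d (f (e x)))) (ladd L (t (e (d (f x))))
        (ladd L (t (e (f (d x)))) (ladd L (t (f (d (e x)))) (t (f (e (d x))))))))"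
      using x def by (simp add: R add.m_ac t_def)
    also have "\<dots> = lzero L" using x def by (simp add: R t)
    finally show "ladd ?D (ladd ?D (lbracket ?D d (lbracket ?D e f))
        (lbracket ?D e (lbracket ?D f d))) (lbracket ?D f (lbracket ?D d e)) x = lzero ?D x"
      using x by (simp add: R)
  qed (use def in \<open>simp_all add: R\<close>)
qed (auto intro!: derivations_eqI simp: carrier_derivation_algebra derivation_algebra_apply
    derivation_algebra_closed zero_derivation derivationsD scale_closed scale_add_right
    scale_add_left scale_scale scale_one add.m_ac add_minus mult.commute)

end

section \<open>The Lorentz type algebra\<close>

abbreviation lorentz_basis :: "6 \<Rightarrow> 'r::comm_ring_1 ^ 6" where
  "lorentz_basis i \<equiv> axis i 1"

text \<open>The alternating bilinear map with the prescribed values on pairs of basis vectors: the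
  coefficient of \<open>[b\<^sub>i, b\<^sub>j]\<close>, \<open>i < j\<close>, in \<open>[x, y]\<close> is \<open>x\<^sub>i y\<^sub>j - x\<^sub>j y\<^sub>i\<close>. Note that
  \<open>(6::6) = 0\<close>; the six indices \<open>1, \<dots>, 6\<close> are nevertheless distinct and exhaust the type.\<close>

definition lorentz_bracket :: "'r::comm_ring_1 ^ 6 \<Rightarrow> 'r ^ 6 \<Rightarrow> 'r ^ 6" where
  "lorentz_bracket x y =
     (let w = (\<lambda>i j. x $ i * y $ j - x $ j * y $ i); b = lorentz_basis in
        w 1 2 *s b 4 + w 1 3 *s b 5 + w 1 4 *s b 2 + w 1 5 *s b 3 + w 1 6 *s 0
      + w 2 3 *s b 6 + w 2 4 *s (- b 1) + w 2 5 *s 0 + w 2 6 *s b 3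
      + w 3 4 *s 0 + w 3 5 *s (- b 1) + w 3 6 *s (- b 2)
      + w 4 5 *s (- b 6) + w 4 6 *s b 5
      + w 5 6 *s (- b 4))"

definition lorentz_algebra :: "('r::comm_ring_1, 'r ^ 6) lie_alg" where
  "lorentz_algebra = \<lparr>carrier = UNIV, ladd = (+), lzero = 0, lscale = (*s),
     lbracket = lorentz_bracket\<rparr>"

lemma UNIV_6: "(UNIV :: 6 set) = {1, 2, 3, 4, 5, 6}"
proof -
  have "card {1, 2, 3, 4, 5, 6 :: 6} = CARD(6)" by simp
  then show ?thesis using card_subset_eq[of "UNIV :: 6 set" "{1, 2, 3, 4, 5, 6}"] by simp
qed

lemma forall_6: "(\<forall>i::6. P i) \<longleftrightarrow> P 1 \<and> P 2 \<and> P 3 \<and> P 4 \<and> P 5 \<and> P 6"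
  by (metis UNIV_6 UNIV_I insertE empty_iff)

lemma lorentz_bracket_basis:
  fixes b :: "6 \<Rightarrow> 'r::comm_ring_1 ^ 6"
  defines "b \<equiv> lorentz_basis"
  shows
    "lorentz_bracket (b 1) (b 2) = b 4" "lorentz_bracket (b 1) (b 3) = b 5"
    "lorentz_bracket (b 1) (b 4) = b 2" "lorentz_bracket (b 1) (b 5) = b 3"
    "lorentz_bracket (b 1) (b 6) = 0" "lorentz_bracket (b 2) (b 3) = b 6"
    "lorentz_bracket (b 2) (b 4) = - b 1" "lorentz_bracket (b 2) (b 5) = 0"
    "lorentz_bracket (b 2) (b 6) = b 3" "lorentz_bracket (b 3) (b 4) = 0"
    "lorentz_bracket (b 3) (b 5) = - b 1" "lorentz_bracket (b 3) (b 6) = - b 2"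
    "lorentz_bracket (b 4) (b 5) = - b 6" "lorentz_bracket (b 4) (b 6) = b 5"
    "lorentz_bracket (b 5) (b 6) = - b 4"
  by (simp_all add: b_def lorentz_bracket_def Let_def axis_def vec_eq_iff)

lemma lorentz_bracket_nth:
  "lorentz_bracket x y $ 1 = - (x$2 * y$4 - x$4 * y$2) - (x$3 * y$5 - x$5 * y$3)"
  "lorentz_bracket x y $ 2 = (x$1 * y$4 - x$4 * y$1) - (x$3 * y$6 - x$6 * y$3)"
  "lorentz_bracket x y $ 3 = (x$1 * y$5 - x$5 * y$1) + (x$2 * y$6 - x$6 * y$2)"
  "lorentz_bracket x y $ 4 = (x$1 * y$2 - x$2 * y$1) - (x$5 * y$6 - x$6 * y$5)"
  "lorentz_bracket x y $ 5 = (x$1 * y$3 - x$3 * y$1) + (x$4 * y$6 - x$6 * y$4)"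
  "lorentz_bracket x y $ 6 = (x$2 * y$3 - x$3 * y$2) - (x$4 * y$5 - x$5 * y$4)"
  by (simp_all add: lorentz_bracket_def Let_def axis_def)

lemma lie_algebra_lorentz: "lie_algebra (lorentz_algebra :: ('r::comm_ring_1, 'r ^ 6) lie_alg)"
proof (rule lie_algebra.intro)
  show "comm_group \<lparr>carrier = carrier (lorentz_algebra :: ('r, 'r ^ 6) lie_alg),
      mult = ladd lorentz_algebra, one = lzero lorentz_algebra\<rparr>"
  proof (rule comm_groupI)
    fix x :: "'r ^ 6"
    show "\<exists>y\<in>carrier \<lparr>carrier = carrier (lorentz_algebra :: ('r, 'r ^ 6) lie_alg),
        mult = ladd lorentz_algebra, one = lzero lorentz_algebra\<rparr>.
        y \<otimes>\<^bsub>\<lparr>carrier = carrier (lorentz_algebra :: ('r, 'r ^ 6) lie_alg),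
        mult = ladd lorentz_algebra, one = lzero lorentz_algebra\<rparr>\<^esub> x
        = \<one>\<^bsub>\<lparr>carrier = carrier (lorentz_algebra :: ('r, 'r ^ 6) lie_alg),
        mult = ladd lorentz_algebra, one = lzero lorentz_algebra\<rparr>\<^esub>"
      by (rule bexI[of _ "- x"]) (simp_all add: lorentz_algebra_def)
  qed (auto simp: lorentz_algebra_def add_ac)
qed (simp_all add: lorentz_algebra_def vec_eq_iff forall_6 lorentz_bracket_nth algebra_simps)

section \<open>The groups and algebras of 2 by 2 matrices\<close>

definition sl2 :: "('k::field, 'k ^ 2 ^ 2) lie_alg" where
  "sl2 = \<lparr>carrier = {A. trace A = 0}, ladd = (+), lzero = 0,
     lscale = (\<lambda>c A. \<chi> i j. c * A $ i $ j),
     lbracket = (\<lambda>A B. A ** B - B ** A)\<rparr>"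

definition GL2 :: "('k::field ^ 2 ^ 2) monoid" where
  "GL2 = \<lparr>carrier = {A. invertible A}, mult = (**), one = mat 1\<rparr>"

definition GL2_scalars :: "('k::field ^ 2 ^ 2) set" where
  "GL2_scalars = {mat c |c. c \<noteq> 0}"

definition PGL2 :: "('k::field ^ 2 ^ 2) set monoid" where
  "PGL2 = GL2 Mod GL2_scalars"

definition mu2 :: "'k::field monoid" where
  "mu2 = \<lparr>carrier = {x. x \<noteq> 0 \<and> x\<^sup>2 = 1}, mult = (*), one = 1\<rparr>"

definition PGL2_swap :: "'k::field \<Rightarrow>
    ('k ^ 2 ^ 2) set \<times> ('k ^ 2 ^ 2) set \<Rightarrow> ('k ^ 2 ^ 2) set \<times> ('k ^ 2 ^ 2) set" where
  "PGL2_swap x = (\<lambda>p \<in> carrier (PGL2 \<times>\<times> PGL2). if x = - 1 then prod.swap p else p)"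

definition semidirect_product ::
    "('a, 'c) monoid_scheme \<Rightarrow> ('b, 'd) monoid_scheme \<Rightarrow> ('b \<Rightarrow> 'a \<Rightarrow> 'a) \<Rightarrow> ('a \<times> 'b) monoid" where
  "semidirect_product N H \<phi> = \<lparr>carrier = carrier N \<times> carrier H,
     mult = (\<lambda>(n, h) (n', h'). (n \<otimes>\<^bsub>N\<^esub> \<phi> h n', h \<otimes>\<^bsub>H\<^esub> h')),
     one = (\<one>\<^bsub>N\<^esub>, \<one>\<^bsub>H\<^esub>)\<rparr>"

lemma lie_algebra_sl2: "lie_algebra (sl2 :: ('k::field, 'k ^ 2 ^ 2) lie_alg)"
proof (rule lie_algebra.intro)
  show "comm_group \<lparr>carrier = carrier (sl2 :: ('k, 'k ^ 2 ^ 2) lie_alg),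
      mult = ladd sl2, one = lzero sl2\<rparr>"
  proof (rule comm_groupI)
    fix x :: "'k ^ 2 ^ 2"
    let ?G = "\<lparr>carrier = carrier (sl2 :: ('k, 'k ^ 2 ^ 2) lie_alg),
        mult = ladd sl2, one = lzero sl2\<rparr>"
    assume "x \<in> carrier ?G"
    then show "\<exists>y\<in>carrier ?G. y \<otimes>\<^bsub>?G\<^esub> x = \<one>\<^bsub>?G\<^esub>"
      by (intro bexI[of _ "- x"]) (simp_all add: sl2_def trace_def sum_negf)
  qed (auto simp: sl2_def add_ac trace_add, simp_all add: trace_def)
next
  fix x y :: "'k ^ 2 ^ 2" and c :: 'k
  assume x: "x \<in> carrier sl2"
  then show "lscale sl2 c x \<in> carrier sl2"
    by (simp add: sl2_def trace_def flip: sum_distrib_left)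
  assume y: "y \<in> carrier sl2"
  show "lbracket sl2 x y \<in> carrier sl2"
    by (simp add: sl2_def trace_sub trace_mul_sym[of y x])
qed (simp_all add: sl2_def vec_eq_iff forall_2 sum_2 matrix_matrix_mult_def algebra_simps)

lemma lie_algebra_lie_prod:
  assumes "lie_algebra L" "lie_algebra M"
  shows "lie_algebra (lie_prod L M)"
proof -
  interpret L: lie_algebra L by fact
  interpret M: lie_algebra M by fact
  let ?G = "\<lparr>carrier = carrier (lie_prod L M),
      mult = ladd (lie_prod L M), one = lzero (lie_prod L M)\<rparr>"
  show ?thesis
  proof (rule lie_algebra.intro)
    show "comm_group ?G"
    proof (rule comm_groupI)
      fix x assume "x \<in> carrier ?G"
      then show "\<exists>y\<in>carrier ?G. y \<otimes>\<^bsub>?G\<^esub> x = \<one>\<^bsub>?G\<^esub>"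
        by (intro bexI[of _ "lscale (lie_prod L M) (- 1) x"])
          (auto simp: lie_prod_def L.add_minus M.add_minus L.add.m_comm M.add.m_comm
             L.scale_closed M.scale_closed)
    qed (auto simp: lie_prod_def L.add.m_ac M.add.m_ac)
  qed (auto simp: lie_prod_def L.scale_closed M.scale_closed L.scale_add_right M.scale_add_right
      L.scale_add_left M.scale_add_left L.scale_scale M.scale_scale L.scale_one M.scale_one
      L.bracket_closed M.bracket_closed L.bracket_add_left M.bracket_add_left
      L.bracket_add_right M.bracket_add_right L.bracket_scale_left M.bracket_scale_left
      L.bracket_scale_right M.bracket_scale_right L.bracket_self M.bracket_self
      L.jacobi M.jacobi)
qed

lemma group_GL2: "group (GL2 :: ('k::field ^ 2 ^ 2) monoid)"
proof (rule groupI)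
  fix x :: "'k ^ 2 ^ 2" assume "x \<in> carrier GL2"
  then show "\<exists>y\<in>carrier GL2. y \<otimes>\<^bsub>GL2\<^esub> x = \<one>\<^bsub>GL2\<^esub>"
    by (auto simp: GL2_def invertible_def)
next
  show "\<one>\<^bsub>GL2\<^esub> \<in> carrier (GL2 :: ('k ^ 2 ^ 2) monoid)"
    by (auto simp: GL2_def invertible_def intro: exI[of _ "mat 1"])
qed (auto simp: GL2_def invertible_mult matrix_mul_assoc)

lemma mat_matrix_mult:
  fixes A :: "'k::field ^ 2 ^ 2"
  shows "(mat c ** A) = (\<chi> i j. c * A $ i $ j)" "(A ** mat c) = (\<chi> i j. c * A $ i $ j)"
  by (simp_all add: matrix_matrix_mult_def mat_def vec_eq_iff forall_2 sum_2)

lemma mat_mult_mat: "(mat c :: 'k::field ^ 2 ^ 2) ** mat d = mat (c * d)"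
  by (simp add: mat_matrix_mult) (simp add: mat_def vec_eq_iff)

lemma normal_GL2_scalars: "GL2_scalars \<lhd> (GL2 :: ('k::field ^ 2 ^ 2) monoid)"
proof -
  interpret group "GL2 :: ('k ^ 2 ^ 2) monoid" by (rule group_GL2)
  have inv: "invertible (mat c :: 'k ^ 2 ^ 2)" if "c \<noteq> 0" for c
    using that mat_mult_mat[of c "inverse c"] mat_mult_mat[of "inverse c" c]
    by (auto simp: invertible_def intro!: exI[of _ "mat (inverse c)"])
  have sub: "subgroup GL2_scalars (GL2 :: ('k ^ 2 ^ 2) monoid)"
  proof (rule subgroupI)
    show "GL2_scalars \<subseteq> carrier (GL2 :: ('k ^ 2 ^ 2) monoid)"
      using inv by (auto simp: GL2_scalars_def GL2_def)
    show "(GL2_scalars :: ('k ^ 2 ^ 2) set) \<noteq> {}"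
      by (auto simp: GL2_scalars_def intro: exI[of _ 1])
  next
    fix a :: "'k ^ 2 ^ 2" assume "a \<in> GL2_scalars"
    then obtain c where c: "a = mat c" "c \<noteq> 0" by (auto simp: GL2_scalars_def)
    have "inv\<^bsub>GL2\<^esub> a = mat (inverse c)"
      using c inv by (intro inv_equality) (simp_all add: GL2_def mat_mult_mat)
    then show "inv\<^bsub>GL2\<^esub> a \<in> GL2_scalars" using c by (auto simp: GL2_scalars_def)
  next
    fix a b :: "'k ^ 2 ^ 2" assume "a \<in> GL2_scalars" "b \<in> GL2_scalars"
    then show "a \<otimes>\<^bsub>GL2\<^esub> b \<in> GL2_scalars"
      by (auto simp: GL2_scalars_def GL2_def mat_mult_mat)
  qed
  show ?thesis
  proof (rule normalI[OF sub], intro ballI)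
    fix x :: "'k ^ 2 ^ 2"
    show "GL2_scalars #>\<^bsub>GL2\<^esub> x = x <#\<^bsub>GL2\<^esub> GL2_scalars"
      by (auto simp: r_coset_def l_coset_def GL2_scalars_def GL2_def mat_matrix_mult)
  qed
qed

lemma group_PGL2: "group (PGL2 :: ('k::field ^ 2 ^ 2) set monoid)"
  unfolding PGL2_def by (rule normal.factorgroup_is_group[OF normal_GL2_scalars])

lemma carrier_mu2: "carrier (mu2 :: 'k::field monoid) = {1, - 1}"
  by (auto simp: mu2_def power2_eq_1_iff)

lemma group_mu2: "group (mu2 :: 'k::field monoid)"
  by (rule groupI) (auto simp: mu2_def power_mult_distrib power2_eq_1_iff)

lemma PGL2_swap_hom:
  assumes "CHAR('k::field) \<noteq> 2"
  shows "PGL2_swap \<in> hom (mu2 :: 'k monoid) (AutoGroup (PGL2 \<times>\<times> PGL2))"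
proof -
  have "(2 :: 'k) \<noteq> 0"
    using assms CHAR_eqI[where ?'a = 'k and c = 2]
    by (metis CHAR_eq_posI less_2_cases of_nat_1 of_nat_numeral one_neq_zero zero_less_numeral
         One_nat_def neq0_conv)
  then have ne: "(1 :: 'k) \<noteq> - 1" by (metis eq_neg_iff_add_eq_0 one_add_one)
  interpret P: group "PGL2 :: ('k ^ 2 ^ 2) set monoid" by (rule group_PGL2)
  let ?C = "carrier (PGL2 :: ('k ^ 2 ^ 2) set monoid)"
  have auto: "PGL2_swap x \<in> auto (PGL2 \<times>\<times> PGL2)" for x :: 'k
  proof -
    have "bij_betw (\<lambda>p. if x = - 1 then prod.swap p else p) (?C \<times> ?C) (?C \<times> ?C)"
      by (rule bij_betw_byWitness[where f' = "\<lambda>p. if x = - 1 then prod.swap p else p"]) auto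
    then have "PGL2_swap x \<in> Bij (?C \<times> ?C)"
      by (simp add: PGL2_swap_def Bij_def)
    then show ?thesis
      by (auto simp: auto_def hom_def PGL2_swap_def DirProd_def)
  qed
  show ?thesis
  proof (rule homI)
    fix x y :: 'k assume "x \<in> carrier mu2" "y \<in> carrier mu2"
    then have xy: "x \<in> {1, - 1}" "y \<in> {1, - 1}" by (simp_all add: carrier_mu2)
    have "PGL2_swap (x * y) = compose (?C \<times> ?C) (PGL2_swap x) (PGL2_swap y)"
      using xy ne by (auto simp: PGL2_swap_def compose_def fun_eq_iff)
    then show "PGL2_swap (x \<otimes>\<^bsub>mu2\<^esub> y)
        = PGL2_swap x \<otimes>\<^bsub>AutoGroup (PGL2 \<times>\<times> PGL2)\<^esub> PGL2_swap y"
      using auto[of x] auto[of y] by (simp add: mu2_def AutoGroup_def BijGroup_def auto_def)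
  qed (simp add: AutoGroup_def auto)
qed

lemma group_semidirect_product:
  assumes "group N" "group H" "\<phi> \<in> hom H (AutoGroup N)"
  shows "group (semidirect_product N H \<phi>)"
proof -
  interpret N: group N by fact
  interpret H: group H by fact
  interpret \<phi>: group_hom H "AutoGroup N" \<phi>
    using assms N.AutoGroup by (simp add: group_hom_def group_hom_axioms_def)
  have auto: "\<phi> h \<in> auto N" if "h \<in> carrier H" for h
    using \<phi>.hom_closed[OF that] by (simp add: AutoGroup_def)
  have closed: "\<phi> h n \<in> carrier N" if "h \<in> carrier H" "n \<in> carrier N" for h n
    using auto[OF that(1)] that(2) by (auto simp: auto_def hom_def)
  have mult: "\<phi> h (n \<otimes>\<^bsub>N\<^esub> n') = \<phi> h n \<otimes>\<^bsub>N\<^esub> \<phi> h n'"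
    if "h \<in> carrier H" "n \<in> carrier N" "n' \<in> carrier N" for h n n'
    using auto[OF that(1)] that(2,3) by (auto simp: auto_def hom_def)
  have comp: "\<phi> (h \<otimes>\<^bsub>H\<^esub> h') n = \<phi> h (\<phi> h' n)"
    if "h \<in> carrier H" "h' \<in> carrier H" "n \<in> carrier N" for h h' n
    using \<phi>.hom_mult[OF that(1,2)] auto[OF that(1)] auto[OF that(2)] that(3)
    by (simp add: AutoGroup_def BijGroup_def auto_def compose_def)
  have one: "\<phi> \<one>\<^bsub>H\<^esub> n = n" if "n \<in> carrier N" for n
    using \<phi>.hom_one that by (simp add: AutoGroup_def BijGroup_def)
  show ?thesis
  proof (rule groupI)
    fix x assume "x \<in> carrier (semidirect_product N H \<phi>)"
    then obtain n h where x: "x = (n, h)" "n \<in> carrier N" "h \<in> carrier H"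
      by (auto simp: semidirect_product_def)
    show "\<exists>y\<in>carrier (semidirect_product N H \<phi>).
        y \<otimes>\<^bsub>semidirect_product N H \<phi>\<^esub> x = \<one>\<^bsub>semidirect_product N H \<phi>\<^esub>"
      using x closed[of "inv\<^bsub>H\<^esub> h" n]
      by (intro bexI[of _ "(inv\<^bsub>N\<^esub> \<phi> (inv\<^bsub>H\<^esub> h) n, inv\<^bsub>H\<^esub> h)"])
        (auto simp: semidirect_product_def simp del: \<phi>.hom_inv)
  qed (auto simp: semidirect_product_def closed mult comp one N.m_assoc H.m_assoc
      simp del: \<phi>.hom_mult \<phi>.hom_one)
qed

end

theory Submission
  imports Defs
begin

text \<open>
  Since \<open>K\<close> contains a square root of \<open>- 1\<close>, the complex structure on the Lorentz type algebra splits
  it into two ideals isomorphic to \<open>sl\<^sub>2\<close>, and derivations and automorphisms are transported along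
  this splitting. As \<open>sl\<^sub>2\<close> is perfect, a derivation of the product preserves the factors, and on
  each factor it is inner; as the centre is trivial, the product is its own derivation algebra.
  A nonzero endomorphism of \<open>sl\<^sub>2\<close> is conjugation by an invertible matrix, hence surjective.
  The components of an automorphism of the product landing in the same factor commute, so exactly
  one of them is nonzero: the automorphism is a pair of conjugations, possibly followed by the swap.
\<close>

section \<open>Homomorphisms, derivations and automorphisms\<close>

text \<open>\<open>K\<close> is arbitrary apart from its characteristic and the root
  \<open>i\<close>, so eigenvalues and weights of a matrix need not lie in \<open>K\<close>. What
  keeps the classification of endomorphisms rational is nilpotency. Let H', E', F' be the images of
  the standard basis H, E, F. Then 2 tr(E'^2) = tr([H', E'] E') = 0, and a traceless 2 by 2 matrix
  squares to a scalar, so E'^2 = 0; likewise F'^2 = 0. A nonzero column of F' is then an eigenvector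
  of H' over \<open>K\<close> itself, and only powers of two are ever inverted.

  The splitting comes from viewing the Lorentz type algebra as \<open>sl2\<close> over K[J] with J^2
  = -1. As \<open>i\<close> lies in \<open>K\<close>, sending J to (i, -i) identifies K[J] with K x
  K. Under this identification the swap of the two factors is the conjugation sending J to
  -J.\<close>

lemma lie_homD:
  assumes "f \<in> lie_hom L M" "x \<in> carrier L"
  shows "f x \<in> carrier M" "f (lscale L c x) = lscale M c (f x)"
    and "y \<in> carrier L \<Longrightarrow> f (ladd L x y) = ladd M (f x) (f y)"
    and "y \<in> carrier L \<Longrightarrow> f (lbracket L x y) = lbracket M (f x) (f y)"
  using assms by (auto simp: lie_hom_def lie_linear_def)

lemma lie_homI:
  assumes "\<And>x. x \<in> carrier L \<Longrightarrow> f x \<in> carrier M"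
    and "\<And>x y. \<lbrakk>x \<in> carrier L; y \<in> carrier L\<rbrakk> \<Longrightarrow> f (ladd L x y) = ladd M (f x) (f y)"
    and "\<And>c x. x \<in> carrier L \<Longrightarrow> f (lscale L c x) = lscale M c (f x)"
    and "\<And>x y. \<lbrakk>x \<in> carrier L; y \<in> carrier L\<rbrakk> \<Longrightarrow> f (lbracket L x y) = lbracket M (f x) (f y)"
  shows "f \<in> lie_hom L M"
  using assms by (auto simp: lie_hom_def lie_linear_def)

lemma lie_isomorphicI:
  assumes "f \<in> lie_hom L M" "\<And>y. y \<in> carrier M \<Longrightarrow> g y \<in> carrier L"
    and "\<And>x. x \<in> carrier L \<Longrightarrow> g (f x) = x" "\<And>y. y \<in> carrier M \<Longrightarrow> f (g y) = y"
  shows "lie_isomorphic L M"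
  unfolding lie_isomorphic_def using assms lie_homD(1)[OF assms(1)]
  by (intro bexI[of _ f] bij_betw_byWitness[where f' = g]) auto

lemma lie_isomorphic_trans:
  assumes "lie_isomorphic L M" "lie_isomorphic M N"
  shows "lie_isomorphic L N"
proof -
  obtain f g where f: "f \<in> lie_hom L M" "bij_betw f (carrier L) (carrier M)"
    and g: "g \<in> lie_hom M N" "bij_betw g (carrier M) (carrier N)"
    using assms by (auto simp: lie_isomorphic_def)
  have "g \<circ> f \<in> lie_hom L N"
    by (rule lie_homI) (simp_all add: lie_homD[OF f(1)] lie_homD[OF g(1)])
  then show ?thesis using bij_betw_trans[OF f(2) g(2)] by (auto simp: lie_isomorphic_def)
qed

context lie_algebra
begin

text \<open>Injectivity of \<open>f\<close> and closure of \<open>L\<close> under its operations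
  make the inverse a homomorphism. Only \<open>L\<close> has to be a Lie algebra, so an isomorphism
  can be reversed without knowing the laws in \<open>M\<close>.\<close>

lemma lie_isomorphicE:
  assumes "lie_isomorphic L M"
  obtains f g where "f \<in> lie_hom L M" "g \<in> lie_hom M L"
    "\<And>x. x \<in> carrier L \<Longrightarrow> g (f x) = x" "\<And>y. y \<in> carrier M \<Longrightarrow> f (g y) = y"
proof -
  obtain f where f: "f \<in> lie_hom L M" and bij: "bij_betw f (carrier L) (carrier M)"
    using assms by (auto simp: lie_isomorphic_def)
  let ?g = "inv_into (carrier L) f"
  have g: "?g y \<in> carrier L" "f (?g y) = y" if "y \<in> carrier M" for y
    using bij that by (auto simp: bij_betw_def inv_into_into f_inv_into_f)
  have gf: "?g (f x) = x" if "x \<in> carrier L" for x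
    using bij that by (auto simp: bij_betw_def)
  have "?g \<in> lie_hom M L"
  proof (rule lie_homI)
    fix x y c assume x: "x \<in> carrier M"
    show "?g x \<in> carrier L" using g x by blast
    show "?g (lscale M c x) = lscale L c (?g x)"
      using gf[of "lscale L c (?g x)"] g[OF x] by (simp add: lie_homD[OF f] scale_closed)
    assume y: "y \<in> carrier M"
    show "?g (ladd M x y) = ladd L (?g x) (?g y)"
      using gf[of "ladd L (?g x) (?g y)"] g[OF x] g[OF y] by (simp add: lie_homD[OF f])
    show "?g (lbracket M x y) = lbracket L (?g x) (?g y)"
      using gf[of "lbracket L (?g x) (?g y)"] g[OF x] g[OF y]
      by (simp add: lie_homD[OF f] bracket_closed)
  qed
  then show ?thesis using that f g gf by blast
qed

lemma lie_isomorphic_sym: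
  assumes "lie_isomorphic L M"
  shows "lie_isomorphic M L"
proof -
  obtain f g where "f \<in> lie_hom L M" "g \<in> lie_hom M L"
    "\<And>x. x \<in> carrier L \<Longrightarrow> g (f x) = x" "\<And>y. y \<in> carrier M \<Longrightarrow> f (g y) = y"
    using lie_isomorphicE[OF assms] by blast
  then show ?thesis using lie_homD(1) by (intro lie_isomorphicI[of g M L f]) auto
qed

text \<open>A derivation is conjugated by the isomorphism. Restricting to the carrier restores
  extensionality, without which the two conjugations would not be mutually inverse.\<close>

lemma lie_isomorphic_derivation_algebra:
  assumes "lie_algebra M" "lie_isomorphic L M"
  shows "lie_isomorphic (derivation_algebra L) (derivation_algebra M)"
proof -
  interpret M: lie_algebra M by fact
  obtain f g where f: "f \<in> lie_hom L M" and g: "g \<in> lie_hom M L"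
    and gf: "\<And>x. x \<in> carrier L \<Longrightarrow> g (f x) = x" and fg: "\<And>y. y \<in> carrier M \<Longrightarrow> f (g y) = y"
    using lie_isomorphicE[OF assms(2)] by blast
  let ?F = "\<lambda>d. \<lambda>y\<in>carrier M. f (d (g y))" and ?G = "\<lambda>d. \<lambda>x\<in>carrier L. g (d (f x))"
  note C = scale_closed bracket_closed M.scale_closed M.bracket_closed
  note F = lie_homD[OF f] lie_homD[OF g] gf fg C
  have F_closed: "?F d \<in> derivations M" if "d \<in> derivations L" for d
    unfolding derivations_def lie_linear_def using that by (auto simp: F derivationsD)
  have G_closed: "?G d \<in> derivations L" if "d \<in> derivations M" for d
    unfolding derivations_def lie_linear_def using that by (auto simp: F M.derivationsD)
  show ?thesis
  proof (rule lie_isomorphicI[of ?F _ _ ?G])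
    show "?F \<in> lie_hom (derivation_algebra L) (derivation_algebra M)"
    proof (rule lie_homI)
    qed (auto simp: carrier_derivation_algebra M.carrier_derivation_algebra F_closed
        derivation_algebra_def F derivationsD fun_eq_iff)
    show "?G (?F d) = d" if "d \<in> carrier (derivation_algebra L)" for d
      using that G_closed[OF F_closed, of d]
      by (intro derivations_eqI) (auto simp: carrier_derivation_algebra F derivationsD)
    show "?F (?G d) = d" if "d \<in> carrier (derivation_algebra M)" for d
      using that F_closed[OF G_closed, of d]
      by (intro M.derivations_eqI) (auto simp: M.carrier_derivation_algebra F M.derivationsD)
  qed (auto simp: carrier_derivation_algebra M.carrier_derivation_algebra G_closed)
qed

section \<open>Automorphism groups under isomorphism\<close>

lemma lie_autoI:
  assumes "f \<in> lie_hom L L" "f \<in> extensional (carrier L)" "\<And>y. y \<in> carrier L \<Longrightarrow> g y \<in> carrier L"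
    and "\<And>x. x \<in> carrier L \<Longrightarrow> g (f x) = x" "\<And>y. y \<in> carrier L \<Longrightarrow> f (g y) = y"
  shows "f \<in> lie_auto L"
  using assms lie_homD(1)[OF assms(1)] unfolding lie_auto_def Bij_def
  by (auto intro: bij_betw_byWitness[where f' = g])

lemma carrier_lie_auto_group: "carrier (lie_auto_group L) = lie_auto L"
  by (simp add: lie_auto_group_def)

lemma mult_lie_auto_group:
  assumes "f \<in> lie_auto L" "g \<in> lie_auto L"
  shows "f \<otimes>\<^bsub>lie_auto_group L\<^esub> g = compose (carrier L) f g"
  using assms by (simp add: lie_auto_group_def lie_auto_def BijGroup_def)

lemma lie_autoD:
  assumes "f \<in> lie_auto L"
  shows "f \<in> lie_hom L L" "f \<in> extensional (carrier L)" "inj_on f (carrier L)"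
    "f ` carrier L = carrier L"
  using assms by (auto simp: lie_auto_def Bij_def bij_betw_def)

lemma lie_auto_eqI:
  assumes "f \<in> lie_auto L" "g \<in> lie_auto L" "\<And>x. x \<in> carrier L \<Longrightarrow> f x = g x"
  shows "f = g"
  using assms by (meson extensionalityI lie_autoD(2))

text \<open>The hypotheses are symmetric in \<open>f\<close> and \<open>g\<close>, so exchanging
  them gives closure of the reverse conjugation as well.\<close>

lemma lie_auto_transport:
  assumes "f \<in> lie_hom L M" "g \<in> lie_hom M L"
    and "\<And>x. x \<in> carrier L \<Longrightarrow> g (f x) = x" "\<And>y. y \<in> carrier M \<Longrightarrow> f (g y) = y"
    and "lie_algebra M" "a \<in> lie_auto L"
  shows "(\<lambda>y\<in>carrier M. f (a (g y))) \<in> lie_auto M"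
proof -
  interpret M: lie_algebra M by fact
  note F = lie_homD[OF assms(1)] lie_homD[OF assms(2)] assms(3,4)
    lie_homD[OF lie_autoD(1)[OF assms(6)]]
    scale_closed bracket_closed M.scale_closed M.bracket_closed
  let ?b = "inv_into (carrier L) a"
  have b: "?b x \<in> carrier L" "a (?b x) = x" "?b (a x) = x" if "x \<in> carrier L" for x
    using lie_autoD(3,4)[OF assms(6)] that by (auto simp: inv_into_into f_inv_into_f)
  show ?thesis
  proof (rule M.lie_autoI[where g = "\<lambda>y. f (?b (g y))"])
    show "(\<lambda>y\<in>carrier M. f (a (g y))) \<in> lie_hom M M"
      by (rule lie_homI) (auto simp: F)
  qed (auto simp: F b)
qed

lemma lie_auto_group_cong:
  assumes "lie_algebra M" "lie_isomorphic L M"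
  shows "lie_auto_group L \<cong> lie_auto_group M"
proof -
  interpret M: lie_algebra M by fact
  obtain f g where f: "f \<in> lie_hom L M" and g: "g \<in> lie_hom M L"
    and gf: "\<And>x. x \<in> carrier L \<Longrightarrow> g (f x) = x" and fg: "\<And>y. y \<in> carrier M \<Longrightarrow> f (g y) = y"
    using lie_isomorphicE[OF assms(2)] by blast
  let ?F = "\<lambda>a. \<lambda>y\<in>carrier M. f (a (g y))" and ?G = "\<lambda>a. \<lambda>x\<in>carrier L. g (a (f x))"
  have F_closed: "?F a \<in> lie_auto M" if "a \<in> lie_auto L" for a
    using lie_auto_transport[OF f g gf fg assms(1) that] .
  have G_closed: "?G a \<in> lie_auto L" if "a \<in> lie_auto M" for a
    using M.lie_auto_transport[OF g f fg gf lie_algebra_axioms that] .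
  note F = lie_homD[OF f] lie_homD[OF g] gf fg
  have "?F \<in> hom (lie_auto_group L) (lie_auto_group M)"
  proof (rule homI)
    fix a b assume "a \<in> carrier (lie_auto_group L)" "b \<in> carrier (lie_auto_group L)"
    then show "?F (a \<otimes>\<^bsub>lie_auto_group L\<^esub> b) = ?F a \<otimes>\<^bsub>lie_auto_group M\<^esub> ?F b"
      by (auto simp: carrier_lie_auto_group mult_lie_auto_group M.mult_lie_auto_group F_closed
          compose_def F lie_homD(1)[OF lie_autoD(1)] fun_eq_iff)
  qed (simp add: carrier_lie_auto_group M.carrier_lie_auto_group F_closed)
  moreover have "?G (?F a) = a" if "a \<in> lie_auto L" for a
    using that G_closed[OF F_closed, of a]
    by (intro lie_auto_eqI) (auto simp: F lie_homD(1)[OF lie_autoD(1)])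
  moreover have "?F (?G a) = a" if "a \<in> lie_auto M" for a
    using that F_closed[OF G_closed, of a]
    by (intro M.lie_auto_eqI) (auto simp: F lie_homD(1)[OF M.lie_autoD(1)])
  ultimately have "?F \<in> iso (lie_auto_group L) (lie_auto_group M)"
    unfolding iso_def carrier_lie_auto_group M.carrier_lie_auto_group using F_closed G_closed
    by (auto intro!: bij_betw_byWitness[where f' = ?G]
         simp: carrier_lie_auto_group M.carrier_lie_auto_group)
  then show ?thesis by (auto simp: is_iso_def)
qed

section \<open>The adjoint map\<close>

lemma bracket_zero:
  assumes "x \<in> carrier L"
  shows "lbracket L x (lzero L) = lzero L" "lbracket L (lzero L) x = lzero L"
  using assms bracket_scale_right[of x "lzero L" 0] bracket_scale_left[of "lzero L" x 0]
  by (simp_all add: bracket_closed scale_zero_left)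

text \<open>The record \<open>lie_alg\<close> has no subtraction; scaling by \<open>- 1\<close>
  plays the role of the additive inverse, and this is its uniqueness.\<close>

lemma eq_if_add_zero:
  assumes "x \<in> carrier L" "y \<in> carrier L" "ladd L x y = lzero L"
  shows "y = lscale L (- 1) x"
proof -
  have "ladd L (lscale L (- 1) x) (ladd L x y) = ladd L (ladd L x (lscale L (- 1) x)) y"
    using assms(1,2) by (simp add: scale_closed add.m_ac)
  then show ?thesis using assms by (simp add: scale_closed add_minus)
qed

lemma bracket_antisym:
  assumes "x \<in> carrier L" "y \<in> carrier L"
  shows "lbracket L y x = lscale L (- 1) (lbracket L x y)"
proof -
  have "lbracket L (ladd L x y) (ladd L x y) = ladd L (lbracket L x y) (lbracket L y x)"
    using assms bracket_self[of x] bracket_self[of y]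
    by (simp add: bracket_add_left bracket_add_right bracket_closed add.m_comm)
  then have "ladd L (lbracket L x y) (lbracket L y x) = lzero L"
    using assms bracket_self[of "ladd L x y"] by simp
  then show ?thesis
    using assms by (intro eq_if_add_zero) (simp_all add: bracket_closed)
qed

text \<open>This is Jacobi in the form used twice below: it says both that bracketing with
  \<open>x\<close> is a derivation and that the adjoint map respects brackets.\<close>

lemma bracket_leibniz:
  assumes "x \<in> carrier L" "y \<in> carrier L" "z \<in> carrier L"
  shows "lbracket L x (lbracket L y z)
    = ladd L (lbracket L (lbracket L x y) z) (lbracket L y (lbracket L x z))"
proof -
  have "lbracket L x (lbracket L y z)
      = lscale L (- 1) (ladd L (lbracket L z (lbracket L x y)) (lbracket L y (lbracket L z x)))"
    using assms jacobi[of x y z] by (intro eq_if_add_zero) (simp_all add: bracket_closed add.m_ac)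
  also have "\<dots> = ladd L (lscale L (- 1) (lbracket L z (lbracket L x y)))
      (lbracket L y (lscale L (- 1) (lbracket L z x)))"
    using assms by (simp add: scale_add_right bracket_closed bracket_scale_right)
  also have "\<dots> = ladd L (lbracket L (lbracket L x y) z) (lbracket L y (lbracket L x z))"
    using assms bracket_antisym[of z "lbracket L x y"] bracket_antisym[of z x]
    by (simp add: bracket_closed)
  finally show ?thesis .
qed

text \<open>The isomorphism is the adjoint map: its kernel is the centre and its image consists of
  the inner derivations.\<close>

lemma lie_isomorphic_derivation_algebra_if_complete:
  assumes center: "\<And>x. \<lbrakk>x \<in> carrier L; \<And>y. y \<in> carrier L \<Longrightarrow> lbracket L x y = lzero L\<rbrakk> \<Longrightarrow> x = lzero L"
    and inner: "\<And>d. d \<in> derivations L \<Longrightarrow>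
      \<exists>x\<in>carrier L. \<forall>y\<in>carrier L. d y = lbracket L x y"
  shows "lie_isomorphic L (derivation_algebra L)"
proof -
  let ?ad = "\<lambda>x. \<lambda>y\<in>carrier L. lbracket L x y"
  have ad: "?ad x \<in> derivations L" if "x \<in> carrier L" for x
    using that unfolding derivations_def lie_linear_def
    by (auto simp: bracket_closed scale_closed bracket_add_right bracket_scale_right
       bracket_leibniz[of x])
  have hom: "?ad \<in> lie_hom L (derivation_algebra L)"
  proof (rule lie_homI)
    fix x y assume xy: "x \<in> carrier L" "y \<in> carrier L"
    have "lbracket L (lbracket L x y) z = ladd L (lbracket L x (lbracket L y z))
        (lscale L (- 1) (lbracket L y (lbracket L x z)))" if "z \<in> carrier L" for z
      using xy that bracket_leibniz[OF xy that]
      by (simp add: bracket_closed scale_closed add.m_assoc add_minus)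
    then show "?ad (lbracket L x y) = lbracket (derivation_algebra L) (?ad x) (?ad y)"
      using xy by (auto simp: derivation_algebra_def bracket_closed fun_eq_iff)
  qed (auto simp: carrier_derivation_algebra ad derivation_algebra_def bracket_closed
      bracket_add_left bracket_scale_left fun_eq_iff)
  have "inj_on ?ad (carrier L)"
  proof (rule inj_onI)
    fix x y assume xy: "x \<in> carrier L" "y \<in> carrier L" and eq: "?ad x = ?ad y"
    have "lbracket L x z = lbracket L y z" if "z \<in> carrier L" for z
      using fun_cong[OF eq, of z] that by simp
    then have "lbracket L (ladd L x (lscale L (- 1) y)) z = lzero L" if "z \<in> carrier L" for z
      using xy that
      by (simp add: scale_closed bracket_add_left bracket_scale_left bracket_closed add_minus)
    then have "ladd L x (lscale L (- 1) y) = lzero L"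
      using xy scale_closed by (blast intro: center add.m_closed)
    then have "lscale L (- 1) y = lscale L (- 1) x"
      using xy by (intro eq_if_add_zero) (simp_all add: scale_closed)
    then have "lscale L (- 1) (lscale L (- 1) y) = lscale L (- 1) (lscale L (- 1) x)" by simp
    then show "x = y" using xy by (simp add: scale_scale scale_one)
  qed
  moreover have "d \<in> ?ad ` carrier L" if "d \<in> derivations L" for d
  proof -
    obtain x where "x \<in> carrier L" "\<forall>y\<in>carrier L. d y = lbracket L x y"
      using inner \<open>d \<in> derivations L\<close> by blast
    then show ?thesis
      using ad[of x] that by (intro image_eqI[of _ _ x] derivations_eqI) auto
  qed
  ultimately show ?thesis
    using hom ad by (auto simp: lie_isomorphic_def bij_betw_def carrier_derivation_algebra)
qed

end

section \<open>Derivations and endomorphisms of \<open>sl\<^sub>2\<close>\<close>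

lemma two_neq_zero_if_CHAR: "CHAR('k::field) \<noteq> 2 \<Longrightarrow> (2 :: 'k) \<noteq> 0"
  using CHAR_eqI[where ?'a = 'k and c = 2]
  by (metis CHAR_eq_posI less_2_cases of_nat_1 of_nat_numeral one_neq_zero zero_less_numeral
      One_nat_def neq0_conv)

lemma power_of_two_neq_zero:
  assumes "(2::'k::field) \<noteq> 0"
  shows "(2::'k) \<noteq> 0" "(4::'k) \<noteq> 0" "(8::'k) \<noteq> 0" "(16::'k) \<noteq> 0" "(32::'k) \<noteq> 0"
  using assms power_not_zero[OF assms, of 2] power_not_zero[OF assms, of 3]
    power_not_zero[OF assms, of 4] power_not_zero[OF assms, of 5]
  by simp_all

text \<open>These are the coordinates with respect to the standard basis H, E, F, with tracelessness
  built in. Below, names such as \<open>h1 h2 h3\<close> are the coordinates of the image of H, and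
  similarly for E and F.\<close>

definition sl2_mat :: "'k::field \<Rightarrow> 'k \<Rightarrow> 'k \<Rightarrow> 'k ^ 2 ^ 2" where
  "sl2_mat x y z = (\<chi> i j. if i = 1 then (if j = 1 then x else y) else (if j = 1 then z else - x))"

lemma sl2_mat_nth [simp]:
  "sl2_mat x y z $ 1 $ 1 = x" "sl2_mat x y z $ 1 $ 2 = y"
  "sl2_mat x y z $ 2 $ 1 = z" "sl2_mat x y z $ 2 $ 2 = - x"
  by (simp_all add: sl2_mat_def)

lemma matrix_2_eq_iff:
  "(A :: 'k ^ 2 ^ 2) = B \<longleftrightarrow> A$1$1 = B$1$1 \<and> A$1$2 = B$1$2 \<and> A$2$1 = B$2$1 \<and> A$2$2 = B$2$2"
  by (simp add: vec_eq_iff forall_2 conj_assoc)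

lemma matrix_mult_2_nth:
  "((A :: 'k::semiring_1 ^ 2 ^ 2) ** B) $ i $ j = A$i$1 * B$1$j + A$i$2 * B$2$j"
  by (simp add: matrix_matrix_mult_def sum_2)

lemma carrier_sl2: "carrier sl2 = {A. A$1$1 + A$2$2 = 0}"
  by (simp add: sl2_def trace_def sum_2)

lemma sl2_mat_in_carrier [simp]: "sl2_mat x y z \<in> carrier sl2"
  by (simp add: carrier_sl2)

lemma sl2_matE:
  assumes "A \<in> carrier sl2"
  obtains x y z where "A = sl2_mat x y z"
proof
  show "A = sl2_mat (A$1$1) (A$1$2) (A$2$1)"
    using assms by (simp add: matrix_2_eq_iff carrier_sl2 add_eq_0_iff)
qed

lemma sl2_mat_eq_iff [simp]: "sl2_mat x y z = sl2_mat x' y' z' \<longleftrightarrow> x = x' \<and> y = y' \<and> z = z'"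
  by (auto simp: matrix_2_eq_iff)

lemma sl2_mat_ops [simp]:
  "ladd sl2 (sl2_mat x y z) (sl2_mat x' y' z') = sl2_mat (x + x') (y + y') (z + z')"
  "lscale sl2 c (sl2_mat x y z) = sl2_mat (c * x) (c * y) (c * z)"
  "lzero sl2 = sl2_mat 0 0 0"
  "lbracket sl2 (sl2_mat x y z) (sl2_mat x' y' z')
    = sl2_mat (y * z' - y' * z) (2 * (x * y' - x' * y)) (2 * (z * x' - z' * x))"
  by (simp_all add: sl2_def matrix_2_eq_iff matrix_mult_2_nth algebra_simps)

lemma lie_linear_sl2_mat:
  assumes f: "f \<in> lie_linear sl2 (sl2 :: ('k::field, 'k ^ 2 ^ 2) lie_alg)"
    and "f (sl2_mat 1 0 0) = sl2_mat h1 h2 h3" "f (sl2_mat 0 1 0) = sl2_mat e1 e2 e3"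
      "f (sl2_mat 0 0 1) = sl2_mat f1 f2 f3"
  shows "f (sl2_mat x y z) = sl2_mat (x * h1 + y * e1 + z * f1) (x * h2 + y * e2 + z * f2)
    (x * h3 + y * e3 + z * f3)"
proof -
  interpret sl2: lie_algebra "sl2 :: ('k, 'k ^ 2 ^ 2) lie_alg" by (rule lie_algebra_sl2)
  have add: "f (ladd sl2 A B) = ladd sl2 (f A) (f B)"
    if "A \<in> carrier sl2" "B \<in> carrier sl2" for A B
    using f that by (auto simp: lie_linear_def)
  have scale: "f (lscale sl2 c A) = lscale sl2 c (f A)" if "A \<in> carrier sl2" for c A
    using f that by (auto simp: lie_linear_def)
  have "sl2_mat x y z = ladd sl2 (ladd sl2 (lscale sl2 x (sl2_mat 1 0 0))
      (lscale sl2 y (sl2_mat 0 1 0))) (lscale sl2 z (sl2_mat 0 0 1))" by simp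
  also have "f \<dots> = ladd sl2 (ladd sl2 (lscale sl2 x (f (sl2_mat 1 0 0)))
      (lscale sl2 y (f (sl2_mat 0 1 0)))) (lscale sl2 z (f (sl2_mat 0 0 1)))"
    by (simp add: add scale sl2.scale_closed del: sl2_mat_ops)
  finally show ?thesis by (simp add: assms(2-))
qed

text \<open>Since \<open>E\<^sup>2 = F\<^sup>2 = 0\<close> and \<open>H F = - F\<close>, any nonzero column \<open>(u, v)\<close> of \<open>F\<close> and its image
  \<open>(s, t)\<close> under \<open>E\<close> form a basis in which the triple is the standard one.\<close>

lemma sl2_triple_basis:
  fixes e1 :: "'k::field"
  assumes two: "(2::'k) \<noteq> 0"
    and EF: "h1 = e2 * f3 - e3 * f2" "h2 = 2 * (e1 * f2 - e2 * f1)" "h3 = 2 * (e3 * f1 - e1 * f3)"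
    and HE: "h2 * e3 - h3 * e2 = 2 * e1" "2 * (h1 * e2 - h2 * e1) = 2 * e2"
      "2 * (h3 * e1 - h1 * e3) = 2 * e3"
    and HF: "h2 * f3 - h3 * f2 = - 2 * f1" "2 * (h1 * f2 - h2 * f1) = - 2 * f2"
      "2 * (h3 * f1 - h1 * f3) = - 2 * f3"
    and nz: "f1 \<noteq> 0 \<or> f2 \<noteq> 0 \<or> f3 \<noteq> 0"
  obtains s t u v where "s * v - t * u \<noteq> 0"
    "h1 * s + h2 * t = s" "h3 * s - h1 * t = t" "h1 * u + h2 * v = - u" "h3 * u - h1 * v = - v"
    "e1 * s + e2 * t = 0" "e3 * s - e1 * t = 0" "e1 * u + e2 * v = s" "e3 * u - e1 * v = t"
    "f1 * s + f2 * t = u" "f3 * s - f1 * t = v" "f1 * u + f2 * v = 0" "f3 * u - f1 * v = 0"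
proof -
  have four: "(4::'k) \<noteq> 0" using two by (rule power_of_two_neq_zero)
  \<comment> \<open>The left side is 2 tr(E^2) = tr([H, E] E), which vanishes by cyclicity of the
    trace. E^2 is the scalar matrix with entry \<open>e1 * e1 + e2 * e3\<close>.\<close>
  have "4 * (e1 * e1 + e2 * e3) = 0" using HE by algebra
  then have E2: "e1 * e1 + e2 * e3 = 0" using four by (simp only: mult_eq_0_iff) simp
  have "4 * (f1 * f1 + f2 * f3) = 0" using HF by algebra
  then have F2: "f1 * f1 + f2 * f3 = 0" using four by (simp only: mult_eq_0_iff) simp
  \<comment> \<open>This is tr(H F) = tr([E, F] F) = 0. For traceless matrices H F + F H is the
    scalar tr(H F), so H and F anticommute and [H, F] = - 2 F turns into H F = - F.\<close>
  have tr: "2 * h1 * f1 + h2 * f3 + h3 * f2 = 0" using EF by algebra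
  have "2 * (h1 * f1 + h2 * f3) = 2 * (- f1)" "2 * (h3 * f2 + h1 * f1) = 2 * f1"
    using tr HF(1) by algebra+
  then have HF1: "h1 * f1 + h2 * f3 = - f1" "h3 * f2 + h1 * f1 = f1"
    using two by (metis mult_left_cancel)+
  have HF2: "h1 * f2 - h2 * f1 = - f2" "h3 * f1 - h1 * f3 = - f3"
  proof -
    have "2 * (h1 * f2 - h2 * f1) = 2 * (- f2)" "2 * (h3 * f1 - h1 * f3) = 2 * (- f3)"
      using HF(2,3) by algebra+
    then show "h1 * f2 - h2 * f1 = - f2" "h3 * f1 - h1 * f3 = - f3"
      using two by (metis mult_left_cancel)+
  qed
  \<comment> \<open>\<open>(u, v)\<close> is the first column of F, or the second one if the first
    vanishes. Lying in the image of F, it is killed by F since F^2 = 0 and negated by H since H F =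
    - F.\<close>
  define u where "u = (if f1 = 0 \<and> f3 = 0 then f2 else f1)"
  define v where "v = (if f1 = 0 \<and> f3 = 0 then - f1 else f3)"
  define s where "s = e1 * u + e2 * v"
  define t where "t = e3 * u - e1 * v"
  have uv: "u \<noteq> 0 \<or> v \<noteq> 0" using nz by (auto simp: u_def v_def)
  have Fp2: "f1 * u + f2 * v = 0" "f3 * u - f1 * v = 0"
    using F2 by (auto simp: u_def v_def algebra_simps)
  have Hp2: "h1 * u + h2 * v = - u" "h3 * u - h1 * v = - v"
    using HF1 HF2 by (auto simp: u_def v_def)
  have Ep1: "e1 * s + e2 * t = 0" "e3 * s - e1 * t = 0"
    using E2 by (auto simp: s_def t_def) algebra+
  \<comment> \<open>Put p = (u, v) and q = (s, t) = E p. From H = E F - F E follow F q = E F p - H p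
    = p and then H q = E F q - F E q = E p = q.\<close>
  have Fp1: "f1 * s + f2 * t = u" "f3 * s - f1 * t = v"
    using EF Hp2 Fp2 s_def t_def by algebra+
  have Hp1: "h1 * s + h2 * t = s" "h3 * s - h1 * t = t"
    using EF Ep1 Fp1 s_def t_def by algebra+
  have "s * v - t * u \<noteq> 0"
  proof
    assume "s * v - t * u = 0"
    \<comment> \<open>If q were proportional to p, then F p = 0 would force p = F q = 0; the two
      squares express this without division.\<close>
    then have "u * u = 0" "v * v = 0" using Fp1 Fp2 by algebra+
    then show False using uv by simp
  qed
  then show ?thesis
    by (rule that[of s v t u])
      (rule Fp1 Fp2 Hp1 Hp2 Ep1 s_def[symmetric] t_def[symmetric])+
qed

lemma invertible_2_iff:
  "invertible (P :: 'k::field ^ 2 ^ 2) \<longleftrightarrow> P$1$1 * P$2$2 - P$1$2 * P$2$1 \<noteq> 0"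
  by (simp add: invertible_det_nz det_2)

text \<open>Composing the two-dimensional representation of \<open>sl2\<close> with \<open>f\<close>
  gives another one, and \<open>P\<close> is the change of basis between them, with columns
  \<open>(s, t)\<close> and \<open>(u, v)\<close>. Stating it as an intertwining relation keeps the
  inverse of \<open>P\<close> out of the calculations.\<close>

lemma lie_hom_sl2_intertwiner:
  assumes two: "(2::'k::field) \<noteq> 0" and f: "f \<in> lie_hom sl2 (sl2 :: ('k, 'k ^ 2 ^ 2) lie_alg)"
    and nz: "A \<in> carrier sl2" "f A \<noteq> 0"
  obtains P where "invertible P" "\<And>B. B \<in> carrier sl2 \<Longrightarrow> f B ** P = P ** B"
proof -
  have lin: "f \<in> lie_linear sl2 sl2" and
    cl: "f B \<in> carrier sl2" if "B \<in> carrier sl2" for B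
    using f that by (auto simp: lie_hom_def lie_linear_def)
  have br: "f (lbracket sl2 B C) = lbracket sl2 (f B) (f C)"
    if "B \<in> carrier sl2" "C \<in> carrier sl2" for B C
    using f that by (auto simp: lie_hom_def)
  obtain h1 h2 h3 where H: "f (sl2_mat 1 0 0) = sl2_mat h1 h2 h3"
    using sl2_matE[OF cl[OF sl2_mat_in_carrier]] .
  obtain e1 e2 e3 where E: "f (sl2_mat 0 1 0) = sl2_mat e1 e2 e3"
    using sl2_matE[OF cl[OF sl2_mat_in_carrier]] .
  obtain f1 f2 f3 where F: "f (sl2_mat 0 0 1) = sl2_mat f1 f2 f3"
    using sl2_matE[OF cl[OF sl2_mat_in_carrier]] .
  note lin_mat = lie_linear_sl2_mat[OF lin[OF sl2_mat_in_carrier] H E F]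
  have EF: "h1 = e2 * f3 - e3 * f2" "h2 = 2 * (e1 * f2 - e2 * f1)" "h3 = 2 * (e3 * f1 - e1 * f3)"
    using br[of "sl2_mat 0 1 0" "sl2_mat 0 0 1"] by (simp_all add: lin_mat algebra_simps)
  have HE: "h2 * e3 - h3 * e2 = 2 * e1" "2 * (h1 * e2 - h2 * e1) = 2 * e2"
      "2 * (h3 * e1 - h1 * e3) = 2 * e3"
    using br[of "sl2_mat 1 0 0" "sl2_mat 0 1 0"] by (simp_all add: lin_mat algebra_simps)
  have HF: "h2 * f3 - h3 * f2 = - 2 * f1" "2 * (h1 * f2 - h2 * f1) = - 2 * f2"
      "2 * (h3 * f1 - h1 * f3) = - 2 * f3"
    using br[of "sl2_mat 1 0 0" "sl2_mat 0 0 1"] by (simp_all add: lin_mat algebra_simps)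
  \<comment> \<open>If F goes to zero, so does H = [E, F], and then E because 2 E = [H, E]; hence
    \<open>f\<close> would vanish.\<close>
  have "f1 \<noteq> 0 \<or> f2 \<noteq> 0 \<or> f3 \<noteq> 0"
  proof (rule ccontr)
    assume *: "\<not> ?thesis"
    then have h: "h1 = 0" "h2 = 0" "h3 = 0" using EF by auto
    then have e: "e1 = 0" "e2 = 0" "e3 = 0" using HE two by auto
    obtain x y z where "A = sl2_mat x y z" using sl2_matE[OF nz(1)] .
    then have "f A = sl2_mat 0 0 0" using lin_mat[of x y z] * h e by simp
    then show False using nz(2) by (simp add: matrix_2_eq_iff)
  qed
  from sl2_triple_basis[OF two EF HE HF this] obtain s t u v where
    nd: "s * v - t * u \<noteq> 0" and
    eqs: "h1 * s + h2 * t = s" "h3 * s - h1 * t = t" "h1 * u + h2 * v = - u" "h3 * u - h1 * v = - v"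
    "e1 * s + e2 * t = 0" "e3 * s - e1 * t = 0" "e1 * u + e2 * v = s" "e3 * u - e1 * v = t"
    "f1 * s + f2 * t = u" "f3 * s - f1 * t = v" "f1 * u + f2 * v = 0" "f3 * u - f1 * v = 0" .
  define P :: "'k ^ 2 ^ 2" where "P = (\<chi> i j.
    if i = 1 then (if j = 1 then s else u) else (if j = 1 then t else v)
      )"
  have P: "P$1$1 = s" "P$1$2 = u" "P$2$1 = t" "P$2$2 = v" by (simp_all add: P_def)
  show ?thesis
  proof (rule that)
    show "invertible P" using nd by (simp add: invertible_2_iff P mult.commute)
    fix B :: "'k ^ 2 ^ 2" assume "B \<in> carrier sl2"
    then obtain x y z where B: "B = sl2_mat x y z" using sl2_matE by blast
    show "f B ** P = P ** B"
      unfolding B lin_mat matrix_2_eq_iff matrix_mult_2_nth sl2_mat_nth P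
    proof (intro conjI)
      have "(x * h1 + y * e1 + z * f1) * s + (x * h2 + y * e2 + z * f2) * t
          = x * (h1 * s + h2 * t) + y * (e1 * s + e2 * t) + z * (f1 * s + f2 * t)"
        by (simp add: algebra_simps)
      also have "\<dots> = s * x + u * z" using eqs by simp
      finally show "(x * h1 + y * e1 + z * f1) * s + (x * h2 + y * e2 + z * f2) * t = s * x + u * z" .
    next
      have "(x * h1 + y * e1 + z * f1) * u + (x * h2 + y * e2 + z * f2) * v
          = x * (h1 * u + h2 * v) + y * (e1 * u + e2 * v) + z * (f1 * u + f2 * v)"
        by (simp add: algebra_simps)
      also have "\<dots> = s * y + u * - x" using eqs by simp
      finally show "(x * h1 + y * e1 + z * f1) * u + (x * h2 + y * e2 + z * f2) * v = s * y + u * - x" .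
    next
      have "(x * h3 + y * e3 + z * f3) * s + - (x * h1 + y * e1 + z * f1) * t
          = x * (h3 * s - h1 * t) + y * (e3 * s - e1 * t) + z * (f3 * s - f1 * t)"
        by (simp add: algebra_simps)
      also have "\<dots> = t * x + v * z" using eqs by simp
      finally show "(x * h3 + y * e3 + z * f3) * s + - (x * h1 + y * e1 + z * f1) * t = t * x + v * z" .
    next
      have "(x * h3 + y * e3 + z * f3) * u + - (x * h1 + y * e1 + z * f1) * v
          = x * (h3 * u - h1 * v) + y * (e3 * u - e1 * v) + z * (f3 * u - f1 * v)"
        by (simp add: algebra_simps)
      also have "\<dots> = t * y + v * - x" using eqs by simp
      finally show "(x * h3 + y * e3 + z * f3) * u + - (x * h1 + y * e1 + z * f1) * v = t * y + v * - x" .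
    qed
  qed
qed

text \<open>The nine coordinates of the images of H, E, F are constrained by applying
  \<open>d\<close> to [H, E] = 2 E, [H, F] = - 2 F and [E, F] = H. Three parameters
  \<open>e1\<close>, \<open>e2\<close>, \<open>f1\<close> survive, as many as the dimension of
  \<open>sl2\<close>.\<close>

lemma sl2_derivation_inner:
  assumes two: "(2::'k::field) \<noteq> 0" and d: "d \<in> derivations (sl2 :: ('k, 'k ^ 2 ^ 2) lie_alg)"
  shows "\<exists>X\<in>carrier sl2. \<forall>A\<in>carrier sl2. d A = lbracket sl2 X A"
proof -
  have lin: "d \<in> lie_linear sl2 sl2" using d by (simp add: derivations_def)
  have cl: "d B \<in> carrier sl2" if "B \<in> carrier sl2" for B
    using d that by (auto simp: derivations_def lie_linear_def)
  have br: "d (lbracket sl2 B C) = ladd sl2 (lbracket sl2 (d B) C) (lbracket sl2 B (d C))"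
    if "B \<in> carrier sl2" "C \<in> carrier sl2" for B C
    using d that by (auto simp: derivations_def)
  obtain h1 h2 h3 where H: "d (sl2_mat 1 0 0) = sl2_mat h1 h2 h3"
    using sl2_matE[OF cl[OF sl2_mat_in_carrier]] .
  obtain e1 e2 e3 where E: "d (sl2_mat 0 1 0) = sl2_mat e1 e2 e3"
    using sl2_matE[OF cl[OF sl2_mat_in_carrier]] .
  obtain f1 f2 f3 where F: "d (sl2_mat 0 0 1) = sl2_mat f1 f2 f3"
    using sl2_matE[OF cl[OF sl2_mat_in_carrier]] .
  note lin_mat = lie_linear_sl2_mat[OF lin H E F]
  have four: "(4::'k) \<noteq> 0" using two by (rule power_of_two_neq_zero)
  have HE: "2 * e1 = - h3" "2 * e2 = 2 * (h1 + e2)" "2 * e3 = 2 * (- e3)"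
    using br[of "sl2_mat 1 0 0" "sl2_mat 0 1 0"] by (simp_all add: lin_mat algebra_simps)
  have HF: "2 * f1 = - h2" "2 * f2 = 2 * (- f2)"
    using br[of "sl2_mat 1 0 0" "sl2_mat 0 0 1"]
    by (auto simp: lin_mat algebra_simps)
  have EF: "h1 = e2 + f3"
    using br[of "sl2_mat 0 1 0" "sl2_mat 0 0 1"] by (simp_all add: lin_mat algebra_simps)
  have "4 * e3 = 0" "4 * f2 = 0" using HE HF by algebra+
  then have z: "e3 = 0" "f2 = 0" using four by auto
  have h1: "h1 = 0" using HE(2) two by simp
  have h: "h3 = - 2 * e1" "h2 = - 2 * f1" "f3 = - e2" using HE(1) HF(1) EF h1 by algebra+
  \<comment> \<open>For X = \<open>sl2_mat x y z\<close> one has [X, E] =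
    \<open>sl2_mat (- z) (2 * x) 0\<close> and [X, F] = \<open>sl2_mat y 0 (- 2 * x)\<close>;
    comparing with the images of E and F gives the entries.\<close>
  let ?X = "sl2_mat (e2 / 2) f1 (- e1)"
  have "d A = lbracket sl2 ?X A" if "A \<in> carrier sl2" for A
  proof -
    obtain x y z where A: "A = sl2_mat x y z" using sl2_matE \<open>A \<in> carrier sl2\<close> .
    show ?thesis using two unfolding A lin_mat by (simp add: z h1 h field_simps)
  qed
  then show ?thesis by (intro bexI[of _ ?X]) auto
qed

lemma sl2_center:
  assumes two: "(2::'k::field) \<noteq> 0" and X: "X \<in> carrier (sl2 :: ('k, 'k ^ 2 ^ 2) lie_alg)"
    and "\<And>A. A \<in> carrier sl2 \<Longrightarrow> lbracket sl2 X A = lzero sl2"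
  shows "X = lzero sl2"
proof -
  obtain x y z where X: "X = sl2_mat x y z" using sl2_matE[OF X] .
  show ?thesis
    using assms(3)[of "sl2_mat 1 0 0"] assms(3)[of "sl2_mat 0 1 0"] two by (simp add: X)
qed

text \<open>The diagonal part is a multiple of [E, F] = H. Bracketing with H scales E by 2 and F by
  - 2, which accounts for the halves and the sign.\<close>

lemma sl2_perfect:
  assumes two: "(2::'k::field) \<noteq> 0" and A: "A \<in> carrier (sl2 :: ('k, 'k ^ 2 ^ 2) lie_alg)"
  obtains B C B' C' where "B \<in> carrier sl2" "C \<in> carrier sl2" "B' \<in> carrier sl2" "C' \<in> carrier sl2"
    "A = ladd sl2 (lbracket sl2 B C) (lbracket sl2 B' C')"
proof -
  obtain x y z where A: "A = sl2_mat x y z" using sl2_matE[OF A] .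
  show ?thesis
    by (rule that[of "sl2_mat 0 x 0" "sl2_mat 0 0 1" "sl2_mat 1 0 0" "sl2_mat 0 (y/2) (- z/2)"])
      (use two in \<open>simp_all add: A\<close>)
qed

section \<open>Conjugations and the group \<open>PGL2\<close>\<close>

lemma matrix_inv_mult:
  assumes "invertible P"
  shows "P ** matrix_inv P = mat 1" "matrix_inv P ** P = mat 1"
  using someI_ex[OF assms[unfolded invertible_def]] by (simp_all add: matrix_inv_def)

lemma matrix_inv_unique:
  assumes "invertible P" "P ** Q = mat 1"
  shows "Q = matrix_inv P"
proof -
  have "matrix_inv P ** (P ** Q) = Q"
    by (simp add: matrix_mul_assoc matrix_inv_mult(2)[OF assms(1)])
  then show ?thesis by (simp add: assms(2))
qed

lemma sl2_mat_0: "sl2_mat 0 0 0 = 0"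
  by (simp add: matrix_2_eq_iff)

definition sl2_conj :: "'k::field ^ 2 ^ 2 \<Rightarrow> 'k ^ 2 ^ 2 \<Rightarrow> 'k ^ 2 ^ 2" where
  "sl2_conj P = (\<lambda>A\<in>carrier sl2. P ** A ** matrix_inv P)"

lemma sl2_conj_eqI:
  assumes "invertible P" "A \<in> carrier sl2" "B ** P = P ** A"
  shows "sl2_conj P A = B"
proof -
  have "P ** A ** matrix_inv P = B"
    by (simp add: assms(3)[symmetric] matrix_inv_mult(1)[OF assms(1)] flip: matrix_mul_assoc)
  then show ?thesis using assms(2) by (simp add: sl2_conj_def)
qed

lemma trace_conj:
  fixes P :: "'k::field ^ 2 ^ 2"
  assumes "invertible P"
  shows "trace (P ** A ** matrix_inv P) = trace A" "trace (matrix_inv P ** A ** P) = trace A"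
  using trace_mul_sym[of "P ** A" "matrix_inv P"] trace_mul_sym[of "matrix_inv P ** A" P]
  by (simp_all add: matrix_mul_assoc matrix_inv_mult[OF assms])

lemma sl2_conj_in_auto:
  assumes "invertible P"
  shows "sl2_conj P \<in> lie_auto sl2"
proof -
  interpret sl2: lie_algebra "sl2 :: ('a, 'a ^ 2 ^ 2) lie_alg" by (rule lie_algebra_sl2)
  note inv = matrix_inv_mult[OF assms]
  have cl: "P ** A ** matrix_inv P \<in> carrier sl2" "matrix_inv P ** A ** P \<in> carrier sl2"
    if "A \<in> carrier sl2" for A
    using that trace_conj[OF assms] by (simp_all add: sl2_def)
  have inv': "matrix_inv P ** (P ** A) = A" "P ** (matrix_inv P ** A) = A" for A
    using inv by (simp_all add: matrix_mul_assoc)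
  have hom: "sl2_conj P \<in> lie_hom sl2 sl2"
  proof (rule lie_homI)
    fix A B :: "'a ^ 2 ^ 2" assume AB: "A \<in> carrier sl2" "B \<in> carrier sl2"
    have "P ** A ** matrix_inv P ** (P ** B ** matrix_inv P) = P ** (A ** B) ** matrix_inv P" for A B
      by (simp add: inv' flip: matrix_mul_assoc)
    moreover have "P ** (A - B) ** matrix_inv P = P ** A ** matrix_inv P - P ** B ** matrix_inv P" for A B
      by (simp add: matrix_2_eq_iff matrix_mult_2_nth algebra_simps)
    ultimately show "sl2_conj P (lbracket sl2 A B) = lbracket sl2 (sl2_conj P A) (sl2_conj P B)"
      using AB sl2.bracket_closed[OF AB] by (simp add: sl2_conj_def) (simp add: sl2_def)
    show "sl2_conj P (ladd sl2 A B) = ladd sl2 (sl2_conj P A) (sl2_conj P B)"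
      using AB sl2.add.m_closed[OF AB]
      by (simp add: sl2_conj_def) (simp add: sl2_def matrix_2_eq_iff matrix_mult_2_nth algebra_simps)
    show "sl2_conj P (lscale sl2 c A) = lscale sl2 c (sl2_conj P A)" for c
      using AB sl2.scale_closed[OF AB(1), of c]
      by (simp add: sl2_conj_def) (simp add: sl2_def matrix_2_eq_iff matrix_mult_2_nth algebra_simps)
  qed (simp add: sl2_conj_def cl)
  show ?thesis
    by (rule sl2.lie_autoI[OF hom, where g = "\<lambda>A. matrix_inv P ** A ** P"])
      (use cl[unfolded matrix_mul_assoc[symmetric]] in \<open>simp_all add: sl2_conj_def inv inv' flip: matrix_mul_assoc\<close>)
qed

lemma lie_hom_sl2_eq_conj:
  assumes "(2::'k::field) \<noteq> 0" "f \<in> lie_hom sl2 (sl2 :: ('k, 'k ^ 2 ^ 2) lie_alg)"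
    and "A \<in> carrier sl2" "f A \<noteq> 0"
  obtains P where "invertible P" "\<And>B. B \<in> carrier sl2 \<Longrightarrow> f B = sl2_conj P B"
proof -
  obtain P where P: "invertible P" "\<And>B. B \<in> carrier sl2 \<Longrightarrow> f B ** P = P ** B"
    using lie_hom_sl2_intertwiner[OF assms] by blast
  show ?thesis
    using P sl2_conj_eqI[OF P(1) _ P(2), symmetric] by (intro that[of P]) auto
qed

lemma sl2_conj_hom: "sl2_conj \<in> hom GL2 (lie_auto_group (sl2 :: ('k::field, 'k ^ 2 ^ 2) lie_alg))"
proof (rule homI)
  interpret sl2: lie_algebra "sl2 :: ('k, 'k ^ 2 ^ 2) lie_alg" by (rule lie_algebra_sl2)
  fix P Q :: "'k ^ 2 ^ 2" assume "P \<in> carrier GL2"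
  then have P: "invertible P" by (simp add: GL2_def)
  then show "sl2_conj P \<in> carrier (lie_auto_group sl2)"
    by (simp add: sl2.carrier_lie_auto_group sl2_conj_in_auto)
  assume "Q \<in> carrier GL2"
  then have Q: "invertible Q" by (simp add: GL2_def)
  have "matrix_inv (P ** Q) = matrix_inv Q ** matrix_inv P"
  proof (rule matrix_inv_unique[symmetric, OF invertible_mult[OF P Q]])
    show "P ** Q ** (matrix_inv Q ** matrix_inv P) = mat 1"
      by (metis P Q matrix_inv_mult(1) matrix_mul_assoc matrix_mul_rid)
  qed
  moreover have "Q ** A ** matrix_inv Q \<in> carrier sl2" if "A \<in> carrier sl2" for A
    using that trace_conj(1)[OF Q] by (simp add: sl2_def)
  ultimately have "sl2_conj (P ** Q) = compose (carrier sl2) (sl2_conj P) (sl2_conj Q)"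
    by (simp add: sl2_conj_def compose_def fun_eq_iff matrix_mul_assoc)
  then show "sl2_conj (P \<otimes>\<^bsub>GL2\<^esub> Q) = sl2_conj P \<otimes>\<^bsub>lie_auto_group sl2\<^esub> sl2_conj Q"
    using P Q by (simp add: sl2.mult_lie_auto_group sl2_conj_in_auto GL2_def)
qed

text \<open>An automorphism is injective, so it does not vanish at H and the classification of
  nonzero endomorphisms applies.\<close>

lemma sl2_conj_surj:
  assumes two: "(2::'k::field) \<noteq> 0"
  shows "sl2_conj ` carrier GL2 = lie_auto (sl2 :: ('k, 'k ^ 2 ^ 2) lie_alg)"
proof (intro equalityI subsetI)
  interpret sl2: lie_algebra "sl2 :: ('k, 'k ^ 2 ^ 2) lie_alg" by (rule lie_algebra_sl2)
  fix f assume f: "f \<in> lie_auto (sl2 :: ('k, 'k ^ 2 ^ 2) lie_alg)"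
  have hom: "f \<in> lie_hom sl2 sl2" using f by (simp add: lie_auto_def)
  have "f (sl2_mat 0 0 0) = 0"
    using lie_homD(2)[OF hom sl2_mat_in_carrier, of 0 0 0 0]
      sl2.scale_zero_left[OF lie_homD(1)[OF hom sl2_mat_in_carrier]]
    by simp (simp add: sl2_mat_0)
  moreover have "inj_on f (carrier sl2)" using f by (rule sl2.lie_autoD(3))
  ultimately have "f (sl2_mat 1 0 0) \<noteq> 0"
    using inj_onD[of f "carrier sl2" "sl2_mat 1 0 0" "sl2_mat 0 0 0"] by auto
  then obtain P where P: "invertible P" "\<And>B. B \<in> carrier sl2 \<Longrightarrow> f B = sl2_conj P B"
    using lie_hom_sl2_eq_conj[OF two hom sl2_mat_in_carrier] by blast
  then have "f = sl2_conj P" using f sl2_conj_in_auto by (intro sl2.lie_auto_eqI)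
  then show "f \<in> sl2_conj ` carrier GL2" using P by (simp add: GL2_def)
qed (auto simp: GL2_def sl2_conj_in_auto)

lemma sl2_conj_kernel:
  "kernel GL2 (lie_auto_group (sl2 :: ('k::field, 'k ^ 2 ^ 2) lie_alg)) sl2_conj = GL2_scalars"
proof -
  interpret sl2: lie_algebra "sl2 :: ('k, 'k ^ 2 ^ 2) lie_alg" by (rule lie_algebra_sl2)
  have one: "\<one>\<^bsub>lie_auto_group sl2\<^esub> = (\<lambda>A\<in>carrier (sl2 :: ('k, 'k ^ 2 ^ 2) lie_alg). A)"
    by (simp add: lie_auto_group_def BijGroup_def)
  have "sl2_conj P = (\<lambda>A\<in>carrier sl2. A) \<longleftrightarrow> P \<in> GL2_scalars" if P: "invertible P" for P :: "'k ^ 2 ^ 2"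
  proof
    assume eq: "sl2_conj P = (\<lambda>A\<in>carrier sl2. A)"
    have com: "P ** A = A ** P" if "A \<in> carrier sl2" for A
    proof -
      have "P ** A ** matrix_inv P = A" using fun_cong[OF eq, of A] that by (simp add: sl2_conj_def)
      then show ?thesis
        by (metis P matrix_inv_mult(2) matrix_mul_assoc matrix_mul_rid)
    qed
    \<comment> \<open>Commuting with E kills the lower left entry and equates the diagonal ones;
      commuting with F kills the upper right entry.\<close>
    have "P$1$2 = 0" "P$2$1 = 0" "P$2$2 = P$1$1"
      using com[of "sl2_mat 0 1 0"] com[of "sl2_mat 0 0 1"]
      by (simp_all add: matrix_2_eq_iff matrix_mult_2_nth)
    then have "P = mat (P$1$1)" "P$1$1 \<noteq> 0"
      using P by (simp_all add: matrix_2_eq_iff mat_def invertible_2_iff)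
    then show "P \<in> GL2_scalars" by (auto simp: GL2_scalars_def)
  next
    assume "P \<in> GL2_scalars"
    then obtain c where "P = mat c" by (auto simp: GL2_scalars_def)
    then have "A ** P = P ** A" for A by (simp add: mat_matrix_mult)
    then have "sl2_conj P A = A" if "A \<in> carrier sl2" for A
      using sl2_conj_eqI[OF P that, of A] by blast
    then show "sl2_conj P = (\<lambda>A\<in>carrier sl2. A)"
      by (auto simp: fun_eq_iff sl2_conj_def)
  qed
  moreover have "GL2_scalars \<subseteq> carrier (GL2 :: ('k ^ 2 ^ 2) monoid)"
    using normal_GL2_scalars normal_imp_subgroup subgroup.subset by blast
  ultimately show ?thesis unfolding kernel_def one by (auto simp: GL2_def)
qed

text \<open>The first isomorphism theorem for \<open>sl2_conj\<close>, whose kernel is the group of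
  scalars.\<close>

lemma PGL2_iso_lie_auto_sl2:
  assumes "(2::'k::field) \<noteq> 0"
  shows "(PGL2 :: ('k ^ 2 ^ 2) set monoid) \<cong> lie_auto_group (sl2 :: ('k, 'k ^ 2 ^ 2) lie_alg)"
proof -
  interpret sl2: lie_algebra "sl2 :: ('k, 'k ^ 2 ^ 2) lie_alg" by (rule lie_algebra_sl2)
  interpret group_hom GL2 "lie_auto_group (sl2 :: ('k, 'k ^ 2 ^ 2) lie_alg)" sl2_conj
    using group_GL2 sl2.group_lie_auto_group sl2_conj_hom
    by (simp add: group_hom_def group_hom_axioms_def)
  have "(\<lambda>X. the_elem (sl2_conj ` X)) \<in> iso (GL2 Mod GL2_scalars)
      (lie_auto_group (sl2 :: ('k, 'k ^ 2 ^ 2) lie_alg))"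
    using FactGroup_iso_set sl2_conj_surj[OF assms]
    by (simp add: sl2_conj_kernel sl2.carrier_lie_auto_group)
  then show ?thesis by (auto simp: PGL2_def is_iso_def)
qed

section \<open>Products of two copies\<close>

lemma carrier_lie_prod: "carrier (lie_prod L M) = carrier L \<times> carrier M"
  by (simp add: lie_prod_def)

lemma lie_prod_ops:
  "ladd (lie_prod L M) (x, y) (x', y') = (ladd L x x', ladd M y y')"
  "lzero (lie_prod L M) = (lzero L, lzero M)"
  "lscale (lie_prod L M) c (x, y) = (lscale L c x, lscale M c y)"
  "lbracket (lie_prod L M) (x, y) (x', y') = (lbracket L x x', lbracket M y y')"
  by (simp_all add: lie_prod_def)

lemma lie_prod_ops_fst_snd:
  "fst (ladd (lie_prod L M) p q) = ladd L (fst p) (fst q)"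
  "snd (ladd (lie_prod L M) p q) = ladd M (snd p) (snd q)"
  "fst (lscale (lie_prod L M) c p) = lscale L c (fst p)"
  "snd (lscale (lie_prod L M) c p) = lscale M c (snd p)"
  "fst (lbracket (lie_prod L M) p q) = lbracket L (fst p) (fst q)"
  "snd (lbracket (lie_prod L M) p q) = lbracket M (snd p) (snd q)"
  by (simp_all add: lie_prod_def split: prod.splits)

text \<open>Perfectness usually asks for finite sums of brackets of any length. Two brackets already
  suffice for \<open>sl2\<close>, so fixing that number avoids sums.\<close>

definition lie_perfect :: "('k, 'v) lie_alg \<Rightarrow> bool" where
  "lie_perfect L \<longleftrightarrow> (\<forall>x\<in>carrier L. \<exists>a\<in>carrier L. \<exists>b\<in>carrier L. \<exists>c\<in>carrier L. \<exists>d\<in>carrier L.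
     x = ladd L (lbracket L a b) (lbracket L c d))"

text \<open>By Leibniz, d(0, [a, b]) = [d(0, a), (0, b)] + [(0, a), d(0, b)], and both brackets have
  first component zero. Perfectness extends this from brackets to the whole second factor, and the
  other factor is symmetric.\<close>

lemma derivation_lie_prodE:
  assumes "lie_algebra L" "lie_algebra M" "lie_perfect L" "lie_perfect M"
    and d: "d \<in> derivations (lie_prod L M)"
  obtains d1 d2 where "d1 \<in> derivations L" "d2 \<in> derivations M"
    "\<And>x y. \<lbrakk>x \<in> carrier L; y \<in> carrier M\<rbrakk> \<Longrightarrow> d (x, y) = (d1 x, d2 y)"
proof -
  interpret L: lie_algebra L by fact
  interpret M: lie_algebra M by fact
  interpret P: lie_algebra "lie_prod L M" by (rule lie_algebra_lie_prod) fact+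
  note D = P.derivationsD[OF d]
  note ops = lie_prod_ops lie_prod_ops_fst_snd carrier_lie_prod
  have cl: "fst (d (x, y)) \<in> carrier L" "snd (d (x, y)) \<in> carrier M"
    if "x \<in> carrier L" "y \<in> carrier M" for x y
    using D(1)[of "(x, y)"] that by (auto simp: carrier_lie_prod mem_Times_iff)
  have zL: "fst (d (lzero L, y)) = lzero L" if y: "y \<in> carrier M" for y
  proof -
    have br: "fst (d (lzero L, lbracket M a b)) = lzero L" if "a \<in> carrier M" "b \<in> carrier M" for a b
      using D(4)[of "(lzero L, a)" "(lzero L, b)"] that
      by (simp add: ops L.bracket_zero cl)
    obtain a b a' b' where ab: "a \<in> carrier M" "b \<in> carrier M" "a' \<in> carrier M" "b' \<in> carrier M"
      "y = ladd M (lbracket M a b) (lbracket M a' b')"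
      using assms(4) y unfolding lie_perfect_def by metis
    then show ?thesis
      using D(3)[of "(lzero L, lbracket M a b)" "(lzero L, lbracket M a' b')"]
      by (simp add: ops br M.bracket_closed)
  qed
  have zM: "snd (d (x, lzero M)) = lzero M" if x: "x \<in> carrier L" for x
  proof -
    have br: "snd (d (lbracket L a b, lzero M)) = lzero M" if "a \<in> carrier L" "b \<in> carrier L" for a b
      using D(4)[of "(a, lzero M)" "(b, lzero M)"] that
      by (simp add: ops M.bracket_zero cl)
    obtain a b a' b' where ab: "a \<in> carrier L" "b \<in> carrier L" "a' \<in> carrier L" "b' \<in> carrier L"
      "x = ladd L (lbracket L a b) (lbracket L a' b')"
      using assms(3) x unfolding lie_perfect_def by metis
    then show ?thesis
      using D(3)[of "(lbracket L a b, lzero M)" "(lbracket L a' b', lzero M)"]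
      by (simp add: ops br L.bracket_closed)
  qed
  let ?d1 = "\<lambda>x\<in>carrier L. fst (d (x, lzero M))" and ?d2 = "\<lambda>y\<in>carrier M. snd (d (lzero L, y))"
  show ?thesis
  proof (rule that[of ?d1 ?d2])
    have "fst (d (ladd L x y, lzero M)) = ladd L (fst (d (x, lzero M))) (fst (d (y, lzero M)))"
      "fst (d (lscale L c x, lzero M)) = lscale L c (fst (d (x, lzero M)))"
      "fst (d (lbracket L x y, lzero M)) =
        ladd L (lbracket L (fst (d (x, lzero M))) y) (lbracket L x (fst (d (y, lzero M))))"
      if "x \<in> carrier L" "y \<in> carrier L" for c x y
      using D(2)[of "(x, lzero M)" c] D(3,4)[of "(x, lzero M)" "(y, lzero M)"] that
      by (simp_all add: ops M.scale_zero M.bracket_zero)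
    then show "?d1 \<in> derivations L"
      unfolding derivations_def lie_linear_def
      by (auto simp: cl L.scale_closed L.bracket_closed)
    have "snd (d (lzero L, ladd M x y)) = ladd M (snd (d (lzero L, x))) (snd (d (lzero L, y)))"
      "snd (d (lzero L, lscale M c x)) = lscale M c (snd (d (lzero L, x)))"
      "snd (d (lzero L, lbracket M x y)) =
        ladd M (lbracket M (snd (d (lzero L, x))) y) (lbracket M x (snd (d (lzero L, y))))"
      if "x \<in> carrier M" "y \<in> carrier M" for c x y
      using D(2)[of "(lzero L, x)" c] D(3,4)[of "(lzero L, x)" "(lzero L, y)"] that
      by (simp_all add: ops L.scale_zero L.bracket_zero)
    then show "?d2 \<in> derivations M"
      unfolding derivations_def lie_linear_def
      by (auto simp: cl M.scale_closed M.bracket_closed)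
    show "d (x, y) = (?d1 x, ?d2 y)" if "x \<in> carrier L" "y \<in> carrier M" for x y
      using D(3)[of "(x, lzero M)" "(lzero L, y)"] that
      by (simp add: ops prod_eq_iff zL zM cl)
  qed
qed

lemma lie_isomorphic_derivation_algebra_sl2_prod:
  assumes two: "(2::'k::field) \<noteq> 0"
  shows "lie_isomorphic (lie_prod sl2 sl2 :: ('k, _) lie_alg) (derivation_algebra (lie_prod sl2 sl2))"
proof -
  interpret sl2: lie_algebra "sl2 :: ('k, 'k ^ 2 ^ 2) lie_alg" by (rule lie_algebra_sl2)
  interpret P: lie_algebra "lie_prod sl2 (sl2 :: ('k, 'k ^ 2 ^ 2) lie_alg)"
    by (intro lie_algebra_lie_prod lie_algebra_sl2)
  show ?thesis
  proof (rule P.lie_isomorphic_derivation_algebra_if_complete)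
    fix p :: "('k ^ 2 ^ 2) \<times> ('k ^ 2 ^ 2)"
    assume p: "p \<in> carrier (lie_prod sl2 sl2)"
      and c: "\<And>q. q \<in> carrier (lie_prod sl2 sl2) \<Longrightarrow> lbracket (lie_prod sl2 sl2) p q = lzero (lie_prod sl2 sl2)"
    obtain X Y where XY: "p = (X, Y)" "X \<in> carrier sl2" "Y \<in> carrier sl2"
      using p by (auto simp: carrier_lie_prod)
    have "lbracket sl2 X A = lzero sl2 \<and> lbracket sl2 Y A = lzero sl2" if "A \<in> carrier sl2" for A
      using c[of "(A, A)"] that XY by (simp add: carrier_lie_prod lie_prod_ops)
    then show "p = lzero (lie_prod sl2 sl2)"
      using sl2_center[OF two XY(2)] sl2_center[OF two XY(3)] by (simp add: XY lie_prod_ops)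
  next
    fix d assume d: "d \<in> derivations (lie_prod sl2 (sl2 :: ('k, 'k ^ 2 ^ 2) lie_alg))"
    have "lie_perfect (sl2 :: ('k, 'k ^ 2 ^ 2) lie_alg)"
      unfolding lie_perfect_def using sl2_perfect[OF two] by metis
    then obtain d1 d2 where d12: "d1 \<in> derivations sl2" "d2 \<in> derivations sl2"
      "\<And>x y. \<lbrakk>x \<in> carrier sl2; y \<in> carrier sl2\<rbrakk> \<Longrightarrow> d (x, y) = (d1 x, d2 y)"
      using derivation_lie_prodE[OF lie_algebra_sl2 lie_algebra_sl2 _ _ d] by metis
    obtain X where X: "X \<in> carrier sl2" "\<forall>A\<in>carrier sl2. d1 A = lbracket sl2 X A"
      using sl2_derivation_inner[OF two d12(1)] by blast
    obtain Y where Y: "Y \<in> carrier sl2" "\<forall>A\<in>carrier sl2. d2 A = lbracket sl2 Y A"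
      using sl2_derivation_inner[OF two d12(2)] by blast
    have "d q = lbracket (lie_prod sl2 sl2) (X, Y) q" if q_in: "q \<in> carrier (lie_prod sl2 sl2)" for q
    proof -
      obtain A B where q: "q = (A, B)" "A \<in> carrier sl2" "B \<in> carrier sl2"
        using q_in by (auto simp: carrier_lie_prod)
      then show ?thesis using X Y by (simp only: q d12(3) lie_prod_ops)
    qed
    moreover have "(X, Y) \<in> carrier (lie_prod sl2 sl2)" using X Y by (simp add: carrier_lie_prod)
    ultimately show "\<exists>x\<in>carrier (lie_prod sl2 sl2). \<forall>y\<in>carrier (lie_prod sl2 sl2).
        d y = lbracket (lie_prod sl2 sl2) x y"
      by blast
  qed
qed

section \<open>Automorphisms of the product\<close>

lemma commuting_lie_homs_sl2:
  assumes two: "(2::'k::field) \<noteq> 0"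
    and f: "f \<in> lie_hom sl2 (sl2 :: ('k, 'k ^ 2 ^ 2) lie_alg)" and g: "g \<in> lie_hom sl2 sl2"
    and comm: "\<And>A B. \<lbrakk>A \<in> carrier sl2; B \<in> carrier sl2\<rbrakk> \<Longrightarrow> lbracket sl2 (g B) (f A) = lzero sl2"
    and nz: "A \<in> carrier sl2" "f A \<noteq> 0" and B: "B \<in> carrier sl2"
  shows "g B = 0"
proof -
  interpret sl2: lie_algebra "sl2 :: ('k, 'k ^ 2 ^ 2) lie_alg" by (rule lie_algebra_sl2)
  obtain P where P: "invertible P" "\<And>C. C \<in> carrier sl2 \<Longrightarrow> f C = sl2_conj P C"
    using lie_hom_sl2_eq_conj[OF two f nz] by blast
  have "g B = lzero sl2"
  \<comment> \<open>Conjugation by \<open>P\<close> is onto, so every element has the form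
    \<open>f D\<close>; hence \<open>g B\<close> is central.\<close>
  proof (rule sl2_center[OF two lie_homD(1)[OF g B]])
    fix C :: "'k ^ 2 ^ 2" assume "C \<in> carrier sl2"
    then obtain D where "D \<in> carrier sl2" "C = sl2_conj P D"
      using sl2.lie_autoD(4)[OF sl2_conj_in_auto[OF P(1)]] by blast
    then show "lbracket sl2 (g B) C = lzero sl2" using comm B P(2) by metis
  qed
  then show ?thesis by (simp add: sl2_mat_0)
qed

lemma nonzero_lie_hom_sl2_auto:
  assumes "(2::'k::field) \<noteq> 0" "f \<in> lie_hom sl2 (sl2 :: ('k, 'k ^ 2 ^ 2) lie_alg)"
    and "A \<in> carrier sl2" "f A \<noteq> 0"
  obtains g where "g \<in> lie_auto sl2" "\<And>B. B \<in> carrier sl2 \<Longrightarrow> f B = g B"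
proof -
  obtain P where P: "invertible P" "\<And>C. C \<in> carrier sl2 \<Longrightarrow> f C = sl2_conj P C"
    using lie_hom_sl2_eq_conj[OF assms] by blast
  show ?thesis by (rule that[of "sl2_conj P"]) (simp_all add: sl2_conj_in_auto P)
qed

lemma lie_hom_lie_prod_components:
  assumes "lie_algebra L" "lie_algebra M" and f: "f \<in> lie_hom (lie_prod L M) (lie_prod L M)"
  shows "(\<lambda>x. fst (f (x, lzero M))) \<in> lie_hom L L" "(\<lambda>x. snd (f (x, lzero M))) \<in> lie_hom L M"
    "(\<lambda>y. fst (f (lzero L, y))) \<in> lie_hom M L" "(\<lambda>y. snd (f (lzero L, y))) \<in> lie_hom M M"
proof -
  interpret L: lie_algebra L by fact
  interpret M: lie_algebra M by fact
  note ops = lie_prod_ops lie_prod_ops_fst_snd carrier_lie_prod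
  note zero = L.scale_zero M.scale_zero L.bracket_zero M.bracket_zero
  have cl: "fst (f (x, y)) \<in> carrier L" "snd (f (x, y)) \<in> carrier M"
    if "x \<in> carrier L" "y \<in> carrier M" for x y
    using lie_homD(1)[OF f, of "(x, y)"] that by (auto simp: carrier_lie_prod mem_Times_iff)
  have "f (ladd L x y, lzero M) = ladd (lie_prod L M) (f (x, lzero M)) (f (y, lzero M))"
    "f (lscale L c x, lzero M) = lscale (lie_prod L M) c (f (x, lzero M))"
    "f (lbracket L x y, lzero M) = lbracket (lie_prod L M) (f (x, lzero M)) (f (y, lzero M))"
    if "x \<in> carrier L" "y \<in> carrier L" for x y c
    using lie_homD(2)[OF f, of "(x, lzero M)" c] lie_homD(3,4)[OF f, of "(x, lzero M)" "(y, lzero M)"] that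
    by (simp_all add: ops zero)
  then show "(\<lambda>x. fst (f (x, lzero M))) \<in> lie_hom L L" "(\<lambda>x. snd (f (x, lzero M))) \<in> lie_hom L M"
    by (auto intro!: lie_homI simp: cl ops)
  have "f (lzero L, ladd M x y) = ladd (lie_prod L M) (f (lzero L, x)) (f (lzero L, y))"
    "f (lzero L, lscale M c x) = lscale (lie_prod L M) c (f (lzero L, x))"
    "f (lzero L, lbracket M x y) = lbracket (lie_prod L M) (f (lzero L, x)) (f (lzero L, y))"
    if "x \<in> carrier M" "y \<in> carrier M" for x y c
    using lie_homD(2)[OF f, of "(lzero L, x)" c] lie_homD(3,4)[OF f, of "(lzero L, x)" "(lzero L, y)"] that
    by (simp_all add: ops zero)
  then show "(\<lambda>y. fst (f (lzero L, y))) \<in> lie_hom M L" "(\<lambda>y. snd (f (lzero L, y))) \<in> lie_hom M M"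
    by (auto intro!: lie_homI simp: cl ops)
qed

text \<open>View \<open>f\<close> as a 2 by 2 matrix of homomorphisms with rows (a, b) and (c, d).
  Within a row the images commute, so at most one entry is nonzero; injectivity makes every column
  nonzero. The nonzero entries therefore sit as in a permutation matrix.\<close>

lemma lie_auto_sl2_prod_cases:
  assumes two: "(2::'k::field) \<noteq> 0"
    and f: "f \<in> lie_auto (lie_prod sl2 (sl2 :: ('k, 'k ^ 2 ^ 2) lie_alg))"
  obtains g h where "g \<in> lie_auto sl2" "h \<in> lie_auto sl2"
      "\<And>A B. \<lbrakk>A \<in> carrier sl2; B \<in> carrier sl2\<rbrakk> \<Longrightarrow> f (A, B) = (g A, h B)"
    | g h where "g \<in> lie_auto sl2" "h \<in> lie_auto sl2"
      "\<And>A B. \<lbrakk>A \<in> carrier sl2; B \<in> carrier sl2\<rbrakk> \<Longrightarrow> f (A, B) = (g B, h A)"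
proof -
  interpret sl2: lie_algebra "sl2 :: ('k, 'k ^ 2 ^ 2) lie_alg" by (rule lie_algebra_sl2)
  interpret P: lie_algebra "lie_prod sl2 (sl2 :: ('k, 'k ^ 2 ^ 2) lie_alg)"
    by (intro lie_algebra_lie_prod lie_algebra_sl2)
  have hom: "f \<in> lie_hom (lie_prod sl2 sl2) (lie_prod sl2 sl2)"
    and inj: "inj_on f (carrier (lie_prod sl2 sl2))"
    using P.lie_autoD[OF f] by auto
  have lzero: "lzero sl2 = (0 :: 'k ^ 2 ^ 2)" by (simp add: sl2_mat_0)
  have zero_in: "0 \<in> carrier (sl2 :: ('k, 'k ^ 2 ^ 2) lie_alg)"
    using sl2.add.one_closed unfolding lzero .
  have ladd: "ladd sl2 = ((+) :: 'k ^ 2 ^ 2 \<Rightarrow> _)" by (simp add: sl2_def)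
  let ?a = "\<lambda>A. fst (f (A, 0))" and ?b = "\<lambda>B. fst (f (0, B))"
    and ?c = "\<lambda>A. snd (f (A, 0))" and ?d = "\<lambda>B. snd (f (0, B))"
  have homs: "?a \<in> lie_hom sl2 sl2" "?c \<in> lie_hom sl2 sl2" "?b \<in> lie_hom sl2 sl2" "?d \<in> lie_hom sl2 sl2"
    using lie_hom_lie_prod_components[OF lie_algebra_sl2 lie_algebra_sl2 hom] unfolding lzero .
  note zero = sl2.bracket_zero[unfolded lzero]
  have "f (lzero (lie_prod sl2 sl2)) = lzero (lie_prod sl2 sl2)"
    using lie_homD(2)[OF hom P.add.one_closed, of 0]
      P.scale_zero_left[OF lie_homD(1)[OF hom P.add.one_closed]]
    by (simp only: P.scale_zero)
  then have f0: "f (0, 0) = (0, 0)" by (simp only: lie_prod_ops(2) lzero)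
  have comm: "lbracket sl2 (?a A) (?b B) = 0" "lbracket sl2 (?c A) (?d B) = 0"
    "lbracket sl2 (?b B) (?a A) = 0" "lbracket sl2 (?d B) (?c A) = 0"
    if AB: "A \<in> carrier sl2" "B \<in> carrier sl2" for A B
  proof -
    have m: "(A, 0) \<in> carrier (lie_prod sl2 sl2)" "(0, B) \<in> carrier (lie_prod sl2 sl2)"
      using AB zero_in by (simp_all add: carrier_lie_prod)
    \<comment> \<open>Both orders are recorded because \<open>commuting_lie_homs_sl2\<close> fixes
      which map stands on the left, and each block appears in either role.\<close>
    have "lbracket (lie_prod sl2 sl2) (A, 0) (0, B) = (0, 0)"
      "lbracket (lie_prod sl2 sl2) (0, B) (A, 0) = (0, 0)"
      using AB by (simp_all add: lie_prod_ops zero)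
    then have "lbracket (lie_prod sl2 sl2) (f (A, 0)) (f (0, B)) = (0, 0)"
      "lbracket (lie_prod sl2 sl2) (f (0, B)) (f (A, 0)) = (0, 0)"
      using lie_homD(4)[OF hom m(1) m(2)] lie_homD(4)[OF hom m(2) m(1)] f0 by metis+
    from arg_cong[OF this(1), of fst] arg_cong[OF this(1), of snd]
      arg_cong[OF this(2), of fst] arg_cong[OF this(2), of snd]
    show "lbracket sl2 (?a A) (?b B) = 0" "lbracket sl2 (?c A) (?d B) = 0"
      "lbracket sl2 (?b B) (?a A) = 0" "lbracket sl2 (?d B) (?c A) = 0"
      by (simp_all add: lie_prod_ops_fst_snd)
  qed
  have split: "f (A, B) = (?a A + ?b B, ?c A + ?d B)"
    if "A \<in> carrier sl2" "B \<in> carrier sl2" for A B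
    using lie_homD(3)[OF hom, of "(A, 0)" "(0, B)"] that zero_in
    by (simp add: carrier_lie_prod lie_prod_ops prod_eq_iff lie_prod_ops_fst_snd ladd)
  \<comment> \<open>One test element suffices: by injectivity at \<open>(H, 0)\<close> and
    \<open>(0, H)\<close>, each column has a block that does not vanish at \<open>H\<close>.\<close>
  define H :: "'k ^ 2 ^ 2" where "H = sl2_mat 1 0 0"
  have H: "H \<in> carrier sl2" "H \<noteq> 0" by (auto simp: H_def matrix_2_eq_iff)
  have ac: "?a H \<noteq> 0 \<or> ?c H \<noteq> 0"
    using inj_onD[OF inj, of "(H, 0)" "(0, 0)"] H zero_in f0
    by (auto simp: carrier_lie_prod prod_eq_iff)
  have bd: "?b H \<noteq> 0 \<or> ?d H \<noteq> 0"
    using inj_onD[OF inj, of "(0, H)" "(0, 0)"] H zero_in f0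
    by (auto simp: carrier_lie_prod prod_eq_iff)
  note comm0 = commuting_lie_homs_sl2[OF two, unfolded lzero]
  show thesis
  proof (cases "?a H = 0")
    case False
    then have b: "?b B = 0" if "B \<in> carrier sl2" for B
      using comm0[OF homs(1,3) comm(3) H(1) False that] by blast
    then have d: "?d H \<noteq> 0" using bd H by auto
    then have c: "?c B = 0" if "B \<in> carrier sl2" for B
      using comm0[OF homs(4,2) comm(2) H(1) d that] by blast
    obtain g where g: "g \<in> lie_auto sl2" "\<And>B. B \<in> carrier sl2 \<Longrightarrow> ?a B = g B"
      using nonzero_lie_hom_sl2_auto[OF two homs(1) H(1) False] by blast
    obtain h where h: "h \<in> lie_auto sl2" "\<And>B. B \<in> carrier sl2 \<Longrightarrow> ?d B = h B"
      using nonzero_lie_hom_sl2_auto[OF two homs(4) H(1) d] by blast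
    show thesis by (rule that(1)[OF g(1) h(1)]) (simp add: split b c g(2) h(2))
  next
    case True
    then have cH: "?c H \<noteq> 0" using ac by simp
    then have d: "?d B = 0" if "B \<in> carrier sl2" for B
      using comm0[OF homs(2,4) comm(4) H(1) cH that] by blast
    then have bH: "?b H \<noteq> 0" using bd H by auto
    then have a: "?a B = 0" if "B \<in> carrier sl2" for B
      using comm0[OF homs(3,1) comm(1) H(1) bH that] by blast
    obtain g where g: "g \<in> lie_auto sl2" "\<And>B. B \<in> carrier sl2 \<Longrightarrow> ?b B = g B"
      using nonzero_lie_hom_sl2_auto[OF two homs(3) H(1) bH] by blast
    obtain h where h: "h \<in> lie_auto sl2" "\<And>B. B \<in> carrier sl2 \<Longrightarrow> ?c B = h B"
      using nonzero_lie_hom_sl2_auto[OF two homs(2) H(1) cH] by blast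
    show thesis by (rule that(2)[OF g(1) h(1)]) (simp add: split a d g(2) h(2))
  qed
qed

text \<open>The flag swaps the arguments before \<open>g\<close> and \<open>h\<close> act. This
  order matches the semidirect product, in which the normal factor stands on the left.\<close>

definition prod_auto :: "('k, 'v) lie_alg \<Rightarrow> ('v \<Rightarrow> 'v) \<Rightarrow> ('v \<Rightarrow> 'v) \<Rightarrow> bool \<Rightarrow> 'v \<times> 'v \<Rightarrow> 'v \<times> 'v" where
  "prod_auto L g h s = (\<lambda>(x, y)\<in>carrier L \<times> carrier L. if s then (g y, h x) else (g x, h y))"

lemma prod_auto_in_auto:
  assumes "lie_algebra L" and g: "g \<in> lie_auto L" and h: "h \<in> lie_auto L"
  shows "prod_auto L g h s \<in> lie_auto (lie_prod L L)"
proof -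
  interpret L: lie_algebra L by fact
  interpret P: lie_algebra "lie_prod L L" by (intro lie_algebra_lie_prod assms)
  note G = L.lie_autoD[OF g] and H = L.lie_autoD[OF h]
  note hom = lie_homD[OF G(1)] lie_homD[OF H(1)] L.scale_closed L.bracket_closed
  let ?g = "inv_into (carrier L) g" and ?h = "inv_into (carrier L) h"
  have inv: "?g x \<in> carrier L" "g (?g x) = x" "?g (g x) = x"
    "?h x \<in> carrier L" "h (?h x) = x" "?h (h x) = x" if "x \<in> carrier L" for x
    using G(3,4) H(3,4) that by (auto simp: inv_into_into f_inv_into_f)
  have "prod_auto L g h s \<in> lie_hom (lie_prod L L) (lie_prod L L)"
    by (rule lie_homI) (auto simp: prod_auto_def carrier_lie_prod lie_prod_ops hom)
  then show ?thesis
    \<comment> \<open>With the swap, the first component is \<open>g y\<close> and the second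
      \<open>h x\<close>, so the inverses are applied crosswise.\<close>
    by (rule P.lie_autoI[where g = "\<lambda>(x, y). if s then (?h y, ?g x) else (?g x, ?h y)"])
      (cases s; auto simp: prod_auto_def carrier_lie_prod inv hom)+
qed

lemma lie_auto_group_sl2_prod_iso:
  assumes two: "(2::'k::field) \<noteq> 0"
  shows "semidirect_product (PGL2 \<times>\<times> PGL2) (mu2 :: 'k monoid) PGL2_swap
    \<cong> lie_auto_group (lie_prod sl2 (sl2 :: ('k, 'k ^ 2 ^ 2) lie_alg))"
proof -
  let ?L = "sl2 :: ('k, 'k ^ 2 ^ 2) lie_alg"
  let ?S = "semidirect_product (PGL2 \<times>\<times> PGL2) (mu2 :: 'k monoid) PGL2_swap"
  interpret sl2: lie_algebra ?L by (rule lie_algebra_sl2)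
  interpret P: lie_algebra "lie_prod ?L ?L" by (intro lie_algebra_lie_prod lie_algebra_sl2)
  obtain \<rho> where \<rho>: "\<rho> \<in> iso (PGL2 :: ('k ^ 2 ^ 2) set monoid) (lie_auto_group ?L)"
    using PGL2_iso_lie_auto_sl2[OF two] by (auto simp: is_iso_def)
  then have \<rho>_auto: "\<rho> p \<in> lie_auto ?L" if "p \<in> carrier PGL2" for p
    using that by (auto simp: iso_def hom_def sl2.carrier_lie_auto_group)
  have \<rho>_mult: "\<rho> (p \<otimes>\<^bsub>PGL2\<^esub> q) = compose (carrier ?L) (\<rho> p) (\<rho> q)"
    if "p \<in> carrier PGL2" "q \<in> carrier PGL2" for p q
    using \<rho> that \<rho>_auto by (auto simp: iso_def hom_def sl2.mult_lie_auto_group)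
  have \<rho>_inj: "inj_on \<rho> (carrier PGL2)" and \<rho>_surj: "\<rho> ` carrier PGL2 = lie_auto ?L"
    using \<rho> by (auto simp: iso_def bij_betw_def sl2.carrier_lie_auto_group)
  have \<rho>_closed: "\<rho> p A \<in> carrier sl2" if "p \<in> carrier PGL2" "A \<in> carrier sl2" for p A
    using lie_homD(1)[OF sl2.lie_autoD(1)[OF \<rho>_auto]] that by blast
  \<comment> \<open>This lets the test \<open>e = - 1\<close> tell the two elements of
    \<open>mu2\<close> apart.\<close>
  have ne: "(1 :: 'k) \<noteq> - 1" using two by (metis eq_neg_iff_add_eq_0 one_add_one)
  define \<Theta> where "\<Theta> = (\<lambda>((p, q), e::'k). prod_auto ?L (\<rho> p) (\<rho> q) (e = - 1))"
  have carr: "x \<in> carrier ?S \<longleftrightarrow> (\<exists>p q e. x = ((p, q), e) \<and> p \<in> carrier PGL2 \<and> q \<in> carrier PGL2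
      \<and> (e = 1 \<or> e = - 1))" for x
    by (auto simp: semidirect_product_def carrier_mu2)
  have \<Theta>_auto: "\<Theta> x \<in> lie_auto (lie_prod ?L ?L)" if "x \<in> carrier ?S" for x
    using that \<rho>_auto by (auto simp: carr \<Theta>_def intro!: prod_auto_in_auto lie_algebra_sl2)
  interpret PGL2: group "PGL2 :: ('k ^ 2 ^ 2) set monoid" by (rule group_PGL2)
  have hom: "\<Theta> \<in> hom ?S (lie_auto_group (lie_prod ?L ?L))"
  proof (rule homI)
    fix x y assume xy: "x \<in> carrier ?S" "y \<in> carrier ?S"
    then obtain p q e p' q' e' where x: "x = ((p, q), e)" "p \<in> carrier PGL2" "q \<in> carrier PGL2"
        "e = 1 \<or> e = - 1"
      and y: "y = ((p', q'), e')" "p' \<in> carrier PGL2" "q' \<in> carrier PGL2" "e' = 1 \<or> e' = - 1"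
      unfolding carr by blast
    \<comment> \<open>Moving the swap past a pair of automorphisms exchanges the pair, which is
      exactly the action \<open>PGL2_swap\<close>.\<close>
    have "\<Theta> (x \<otimes>\<^bsub>?S\<^esub> y) = compose (carrier (lie_prod ?L ?L)) (\<Theta> x) (\<Theta> y)"
      using x(2-4) y(2-4) ne ne[symmetric]
      by (auto simp: x(1) y(1) semidirect_product_def mu2_def PGL2_swap_def \<Theta>_def prod_auto_def
          \<rho>_mult \<rho>_closed compose_def carrier_lie_prod fun_eq_iff)
    then show "\<Theta> (x \<otimes>\<^bsub>?S\<^esub> y) = \<Theta> x \<otimes>\<^bsub>lie_auto_group (lie_prod ?L ?L)\<^esub> \<Theta> y"
      using \<Theta>_auto xy by (simp add: P.mult_lie_auto_group)
  qed (simp add: P.carrier_lie_auto_group \<Theta>_auto)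
  have "inj_on \<Theta> (carrier ?S)"
  proof (rule inj_onI)
    fix x y assume "x \<in> carrier ?S" "y \<in> carrier ?S" and eq: "\<Theta> x = \<Theta> y"
    then obtain p q e p' q' e' where x: "x = ((p, q), e)" "p \<in> carrier PGL2" "q \<in> carrier PGL2"
        "e = 1 \<or> e = - 1"
      and y: "y = ((p', q'), e')" "p' \<in> carrier PGL2" "q' \<in> carrier PGL2" "e' = 1 \<or> e' = - 1"
      unfolding carr by blast
    have zero: "\<rho> r (sl2_mat 0 0 0) = sl2_mat 0 0 0" if "r \<in> carrier PGL2" for r
      using lie_homD(2)[OF sl2.lie_autoD(1)[OF \<rho>_auto[OF that]] sl2_mat_in_carrier, of 0 0 0 0]
        sl2.scale_zero_left[OF \<rho>_closed[OF that sl2_mat_in_carrier, of 0 0 0]]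
      by simp
    have nonzero: "\<rho> r (sl2_mat 1 0 0) \<noteq> sl2_mat 0 0 0" if "r \<in> carrier PGL2" for r
      using inj_onD[OF sl2.lie_autoD(3)[OF \<rho>_auto[OF that]], of "sl2_mat 1 0 0" "sl2_mat 0 0 0"]
        zero[OF that] by auto
    have app: "prod_auto ?L (\<rho> p) (\<rho> q) (e = - 1) (A, B) = prod_auto ?L (\<rho> p') (\<rho> q') (e' = - 1) (A, B)"
      for A B using eq by (simp add: x y \<Theta>_def)
    \<comment> \<open>At (H, 0) the nonzero component of the value is the second one exactly when
      the swap is present.\<close>
    have e: "e = e'"
      using app[of "sl2_mat 1 0 0" "sl2_mat 0 0 0"] x(2-4) y(2-4) ne ne[symmetric]
        nonzero[OF x(2)] nonzero[OF x(3)]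
      by (auto simp: prod_auto_def zero)
    \<comment> \<open>On the diagonal the swap is invisible up to the order of the components, and
      both automorphisms can be read off at once.\<close>
    have "\<rho> p A = \<rho> p' A \<and> \<rho> q A = \<rho> q' A" if "A \<in> carrier sl2" for A
      using app[of A A] that by (auto simp: prod_auto_def e split: if_splits)
    then have "\<rho> p = \<rho> p'" "\<rho> q = \<rho> q'"
      using x y \<rho>_auto by (auto intro!: sl2.lie_auto_eqI)
    then show "x = y" using inj_onD[OF \<rho>_inj] x y e by simp
  qed
  moreover have "f \<in> \<Theta> ` carrier ?S" if f: "f \<in> lie_auto (lie_prod ?L ?L)" for f
  proof -
    have main: "f \<in> \<Theta> ` carrier ?S" if gh: "g \<in> lie_auto ?L" "h \<in> lie_auto ?L" and s: "s = 1 \<or> s = - 1"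
      and eq: "\<And>A B. \<lbrakk>A \<in> carrier sl2; B \<in> carrier sl2\<rbrakk> \<Longrightarrow>
        f (A, B) = (if s = - 1 then (g B, h A) else (g A, h B))" for g h and s :: 'k
    proof -
      obtain p q where pq: "p \<in> carrier PGL2" "q \<in> carrier PGL2" "g = \<rho> p" "h = \<rho> q"
        using gh unfolding \<rho>_surj[symmetric] by blast
      have x: "((p, q), s) \<in> carrier ?S" using pq s by (simp add: carr)
      have "f = \<Theta> ((p, q), s)"
        using f \<Theta>_auto[OF x]
        by (rule P.lie_auto_eqI) (auto simp: carrier_lie_prod \<Theta>_def prod_auto_def eq pq)
      then show ?thesis using x by blast
    qed
    show ?thesis
    proof (cases rule: lie_auto_sl2_prod_cases[OF two f])
      case (1 g h)
      then show ?thesis using ne by (intro main[of g h 1]) auto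
    next
      case (2 g h)
      then show ?thesis by (intro main[of g h "- 1"]) auto
    qed
  qed
  ultimately have "\<Theta> \<in> iso ?S (lie_auto_group (lie_prod ?L ?L))"
    using hom \<Theta>_auto by (auto simp: iso_def bij_betw_def P.carrier_lie_auto_group)
  then show ?thesis by (auto simp: is_iso_def)
qed

section \<open>The splitting of the Lorentz type algebra\<close>

text \<open>The map \<open>b\<^sub>1 \<mapsto> b\<^sub>6\<close>, \<open>b\<^sub>2 \<mapsto> - b\<^sub>5\<close>, \<open>b\<^sub>4 \<mapsto> - b\<^sub>3\<close> extends to a complex structure that
  commutes with the bracket. For \<open>i\<^sup>2 = - 1\<close> its eigenspaces for \<open>\<plusminus> i\<close> are the two factors, and
  \<open>b\<^sub>1, b\<^sub>2, b\<^sub>4\<close> project to \<open>h/2, (e + f)/2, (e - f)/2\<close>.\<close>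

definition lorentz_proj :: "'k::field \<Rightarrow> 'k ^ 6 \<Rightarrow> 'k ^ 2 ^ 2" where
  "lorentz_proj i x = sl2_mat ((x$1 + i * x$6) / 2)
     ((x$2 - i * x$5 + (x$4 - i * x$3)) / 2) ((x$2 - i * x$5 - (x$4 - i * x$3)) / 2)"

text \<open>With J the complex structure, x = (x1 + J x6) b1 + (x2 - J x5) b2 + (x4 - J x3) b4, and
  the map replaces J by \<open>i\<close>. The relations [b1, b2] = b4, [b1, b4] = b2, [b2, b4] = -
  b1 hold for the chosen images in \<open>sl2\<close>. Only the square of \<open>i\<close> matters,
  so the lemma also covers \<open>- i\<close>.\<close>

lemma lorentz_proj_hom:
  assumes two: "(2::'k::field) \<noteq> 0" and i: "i\<^sup>2 = - (1::'k)"
  shows "lorentz_proj i \<in> lie_hom lorentz_algebra sl2"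
proof (rule lie_homI)
  note pow2 = power_of_two_neq_zero[OF two]
  fix x y :: "'k ^ 6" and c
  show "lorentz_proj i (ladd lorentz_algebra x y) = ladd sl2 (lorentz_proj i x) (lorentz_proj i y)"
    "lorentz_proj i (lscale lorentz_algebra c x) = lscale sl2 c (lorentz_proj i x)"
    by (simp_all add: lorentz_algebra_def lorentz_proj_def field_simps pow2)
  have i2: "i * i = - 1" "i * (i * z) = - z" for z
    using i by (simp_all add: power2_eq_square flip: mult.assoc)
  show "lorentz_proj i (lbracket lorentz_algebra x y) = lbracket sl2 (lorentz_proj i x) (lorentz_proj i y)"
    by (simp add: lorentz_algebra_def lorentz_proj_def lorentz_bracket_nth)
      (simp add: field_simps i2 pow2)
qed (simp add: lorentz_proj_def)

lemma lorentz_iso_sl2_prod: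
  assumes two: "(2::'k::field) \<noteq> 0" and i: "i\<^sup>2 = - (1::'k)"
  shows "lie_isomorphic (lorentz_algebra :: ('k, 'k ^ 6) lie_alg) (lie_prod sl2 sl2)"
proof -
  have hom: "lorentz_proj i \<in> lie_hom lorentz_algebra sl2" "lorentz_proj (- i) \<in> lie_hom lorentz_algebra sl2"
    using lorentz_proj_hom[OF two] i by simp_all
  have i2: "i * i = - 1" "i * (i * z) = - z" for z
    using i by (simp_all add: power2_eq_square flip: mult.assoc)
  note pow2 = power_of_two_neq_zero[OF two]
  let ?F = "\<lambda>x. (lorentz_proj i x, lorentz_proj (- i) x)"
  define v :: "'k \<Rightarrow> 'k \<Rightarrow> 'k \<Rightarrow> 'k \<Rightarrow> 'k \<Rightarrow> 'k \<Rightarrow> 'k ^ 6" where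
    "v a b c d e f = (\<chi> j. if j = 1 then a else if j = 2 then b else if j = 3 then c
      else if j = 4 then d else if j = 5 then e else f)" for a b c d e f
  have v: "v a b c d e f $ 1 = a" "v a b c d e f $ 2 = b" "v a b c d e f $ 3 = c"
    "v a b c d e f $ 4 = d" "v a b c d e f $ 5 = e" "v a b c d e f $ 6 = f" for a b c d e f
    by (simp_all add: v_def)
  \<comment> \<open>The two projections are conjugate under exchanging \<open>i\<close> and
    \<open>- i\<close>: their sums recover coordinates 1, 2, 4. Their differences, divided by
    \<open>i\<close> or \<open>- i\<close>, recover 6, 5, 3, using 1 / i = - i.\<close>
  let ?G = "\<lambda>(A, B). v (A$1$1 + B$1$1) ((A$1$2 + A$2$1 + B$1$2 + B$2$1) / 2)
    (i * (A$1$2 - A$2$1 - B$1$2 + B$2$1) / 2) ((A$1$2 - A$2$1 + B$1$2 - B$2$1) / 2)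
    (i * (A$1$2 + A$2$1 - B$1$2 - B$2$1) / 2) (- i * (A$1$1 - B$1$1))"
  show ?thesis
  proof (rule lie_isomorphicI[of ?F _ _ ?G])
    show "?F \<in> lie_hom lorentz_algebra (lie_prod sl2 sl2)"
      by (rule lie_homI) (simp_all add: lie_homD[OF hom(1)] lie_homD[OF hom(2)] carrier_lie_prod lie_prod_ops)
    show "?G (?F x) = x" for x
      by (simp add: vec_eq_iff forall_6 v lorentz_proj_def field_simps i2 pow2)
    fix p :: "('k ^ 2 ^ 2) \<times> ('k ^ 2 ^ 2)" assume "p \<in> carrier (lie_prod sl2 sl2)"
    then obtain a b c a' b' c' where "p = (sl2_mat a b c, sl2_mat a' b' c')"
      by (auto simp: carrier_lie_prod elim!: sl2_matE)
    then show "?F (?G p) = p"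
      by (simp add: v lorentz_proj_def field_simps i2 pow2)
  qed (simp add: lorentz_algebra_def)
qed

theorem lemma14:
  assumes "CHAR('k::field) \<noteq> 2"
    and "\<exists>i::'k. i\<^sup>2 = - 1"
  shows "lie_isomorphic (derivation_algebra (lorentz_algebra :: ('k, 'k ^ 6) lie_alg))
           (lie_prod sl2 sl2) \<and>
         lie_auto_group (lorentz_algebra :: ('k, 'k ^ 6) lie_alg) \<cong>
           semidirect_product (PGL2 \<times>\<times> PGL2) (mu2 :: 'k monoid) PGL2_swap"
proof
  let ?L = "lorentz_algebra :: ('k, 'k ^ 6) lie_alg"
  let ?M = "lie_prod sl2 (sl2 :: ('k, 'k ^ 2 ^ 2) lie_alg)"
  have two: "(2::'k) \<noteq> 0" using assms(1) by (rule two_neq_zero_if_CHAR)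
  interpret L: lie_algebra ?L by (rule lie_algebra_lorentz)
  have M: "lie_algebra ?M" by (intro lie_algebra_lie_prod lie_algebra_sl2)
  then interpret M: lie_algebra ?M .
  \<comment> \<open>The isomorphism is oriented from the product to the Lorentz type algebra, so
    that it composes directly with the results already proved for the product.\<close>
  have iso: "lie_isomorphic ?M ?L"
    using assms(2) lorentz_iso_sl2_prod[OF two] L.lie_isomorphic_sym by blast
  have "lie_isomorphic ?M (derivation_algebra ?L)"
    using lie_isomorphic_derivation_algebra_sl2_prod[OF two]
      M.lie_isomorphic_derivation_algebra[OF lie_algebra_lorentz iso]
    by (rule lie_isomorphic_trans)
  then show "lie_isomorphic (derivation_algebra ?L) ?M" by (rule M.lie_isomorphic_sym)
  have "semidirect_product (PGL2 \<times>\<times> PGL2) (mu2 :: 'k monoid) PGL2_swap \<cong> lie_auto_group ?L"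
    using lie_auto_group_sl2_prod_iso[OF two]
      M.lie_auto_group_cong[OF lie_algebra_lorentz iso] by (rule iso_trans)
  \<comment> \<open>Reversing a group isomorphism requires its source to be a group; this is where
    the swap has to be an action by automorphisms.\<close>
  moreover have "group (semidirect_product (PGL2 \<times>\<times> PGL2) (mu2 :: 'k monoid) PGL2_swap)"
    using assms(1) by (intro group_semidirect_product DirProd_group group_PGL2 group_mu2 PGL2_swap_hom)
  ultimately show "lie_auto_group ?L \<cong> semidirect_product (PGL2 \<times>\<times> PGL2) (mu2 :: 'k monoid) PGL2_swap"
    by (rule group.iso_sym[rotated])
qed

end
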